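(* Let $n\geq 1$ and let $F_n$ be the free group of rank $n$. Then the co-word problem $\mathrm{coW}(\mathrm{Hou}(F_n))$ of the group $\mathrm{Hou}(F_n)$ is a semi-deterministic context-free language.
   Context: Co-word problem: let $G$ be a group with a finite generating set $X$. The co-word problem $\mathrm{coW}(G,X)$ is the set of all words in $(X^{\pm})^*$ (words in the generators and their inverses) that do not represent $1$ in $G$. Semi-deterministic context-free languages: a language is semi-deterministic context-free if it is recognized by a pushdown automaton that may non-deterministically write a word onto its stack before the beginning of the computation (before reading any input), and from then on behaves totally deterministically. (The end of the input word is indicated to the automaton by an end-of-input symbol, and the bottom of the stack by an end-of-stack symbol.) For co-word problems of finitely generated groups this property does not depend on the choice of the finite generating set $X$, so $X$ is omitted from the notation. The group $\mathrm{Hou}(G)$: a quasi-automorphism of a locally finite graph $\Gamma=(V,E)$ is a permutation of $V$ that respects all but finitely many adjacencies. Let $G$ be a group finitely generated by $X$. Then $\mathrm{Hou}(G)$ is the group of those quasi-automorphisms of the Cayley graph of $(G,X)$ that act on all but finitely many vertices like left multiplication by an element of $G$. For infinite $G$, in other words, $\mathrm{Hou}(G)=S_G\rtimes G$, where $S_G$ is the group of all permutations of $G$ with finite support and $G$ acts on itself by left multiplication. This definition is independent of the choice of $X$. If $X=\{x_1,\ldots,x_n\}$ generates $F_n$, then $\mathrm{Hou}(F_n)$ is generated by $x_1,\ldots,x_n$ (acting by left multiplication) together with $\sigma_1,\ldots,\sigma_n$, where $\sigma_i$ is the transposition exchanging $1$ and $x_i$ and fixing all other points. *)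

theory Defs
  imports "HOL-Algebra.Generated_Groups" "HOL-Algebra.Bij"
begin

section \<open>Words over generators and inverses\<close>

text \<open>A letter \<open>(x, True)\<close> stands for \<open>x\<close> and \<open>(x, False)\<close> for the formal inverse of \<open>x\<close>.\<close>

definition inv_letter :: "'a \<times> bool \<Rightarrow> 'a \<times> bool" where
  "inv_letter a = (fst a, \<not> snd a)"

definition letter_val :: "('a, 'm) monoid_scheme \<Rightarrow> 'a \<times> bool \<Rightarrow> 'a" where
  "letter_val G a = (if snd a then fst a else inv\<^bsub>G\<^esub> (fst a))"

definition word_val :: "('a, 'm) monoid_scheme \<Rightarrow> ('a \<times> bool) list \<Rightarrow> 'a" where
  "word_val G w = foldr (\<lambda>a g. letter_val G a \<otimes>\<^bsub>G\<^esub> g) w \<one>\<^bsub>G\<^esub>"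

definition finite_generating_set :: "('a, 'm) monoid_scheme \<Rightarrow> 'a set \<Rightarrow> bool" where
  "finite_generating_set G S \<longleftrightarrow> finite S \<and> S \<subseteq> carrier G \<and> generate G S = carrier G"

definition coW :: "('a, 'm) monoid_scheme \<Rightarrow> 'a set \<Rightarrow> ('a \<times> bool) list set" where
  "coW G S = {w \<in> lists (S \<times> UNIV). word_val G w \<noteq> \<one>\<^bsub>G\<^esub>}"


section \<open>Free groups\<close>

definition reduced :: "('a \<times> bool) list \<Rightarrow> bool" where
  "reduced w \<longleftrightarrow> successively (\<lambda>a b. b \<noteq> inv_letter a) w"

fun cancel_cons :: "'a \<times> bool \<Rightarrow> ('a \<times> bool) list \<Rightarrow> ('a \<times> bool) list" where
  "cancel_cons a [] = [a]"
| "cancel_cons a (b # w) = (if b = inv_letter a then w else a # b # w)"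

definition free_reduce :: "('a \<times> bool) list \<Rightarrow> ('a \<times> bool) list" where
  "free_reduce w = foldr cancel_cons w []"

definition free_group :: "nat \<Rightarrow> (nat \<times> bool) list monoid" where
  "free_group n =
    \<lparr>carrier = {w \<in> lists ({..<n} \<times> UNIV). reduced w},
     mult = (\<lambda>u v. free_reduce (u @ v)),
     one = []\<rparr>"

definition free_basis :: "nat \<Rightarrow> (nat \<times> bool) list set" where
  "free_basis n = (\<lambda>i. [(i, True)]) ` {..<n}"

lemma inv_letter_inv_letter [simp]: "inv_letter (inv_letter a) = a"
  by (simp add: inv_letter_def)

lemma reduced_cancel_cons: "reduced w \<Longrightarrow> reduced (cancel_cons a w)"
  by (cases w) (auto simp: reduced_def successively_Cons)

lemma set_cancel_cons: "set (cancel_cons a w) \<subseteq> insert a (set w)"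
  by (cases w) auto

lemma cancel_cons_inverse:
  "reduced w \<Longrightarrow> cancel_cons a (cancel_cons (inv_letter a) w) = w"
proof (cases w)
  case (Cons b v)
  assume "reduced w"
  with Cons show ?thesis
    by (cases v) (auto simp: reduced_def)
qed simp

lemma reduced_foldr_cancel_cons: "reduced v \<Longrightarrow> reduced (foldr cancel_cons w v)"
  by (induction w) (auto intro: reduced_cancel_cons)

lemma reduced_free_reduce: "reduced (free_reduce w)"
  unfolding free_reduce_def by (rule reduced_foldr_cancel_cons) (simp add: reduced_def)

lemma set_free_reduce: "set (free_reduce w) \<subseteq> set w"
proof (induction w)
  case (Cons a w)
  then show ?case
    using set_cancel_cons[of a "free_reduce w"] by (auto simp: free_reduce_def)
qed (simp add: free_reduce_def)

lemma free_reduce_id: "reduced w \<Longrightarrow> free_reduce w = w"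
proof (induction w)
  case (Cons a w)
  then show ?case
    by (cases w) (auto simp: free_reduce_def reduced_def)
qed (simp add: free_reduce_def)

lemma foldr_cancel_cons_cancel_cons:
  "reduced r \<Longrightarrow> foldr cancel_cons (cancel_cons a w) r = cancel_cons a (foldr cancel_cons w r)"
  by (cases w) (auto simp: cancel_cons_inverse reduced_foldr_cancel_cons)

lemma foldr_cancel_cons_free_reduce:
  "reduced r \<Longrightarrow> foldr cancel_cons (free_reduce w) r = foldr cancel_cons w r"
  by (induction w) (auto simp: free_reduce_def foldr_cancel_cons_cancel_cons)

lemma free_reduce_append_left: "free_reduce (free_reduce u @ v) = free_reduce (u @ v)"
  using foldr_cancel_cons_free_reduce[OF reduced_free_reduce, of u v]
  by (simp add: free_reduce_def)

lemma free_reduce_append_right: "free_reduce (u @ free_reduce v) = free_reduce (u @ v)"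
  using free_reduce_id[OF reduced_free_reduce, of v]
  by (simp add: free_reduce_def)

lemma free_reduce_inverse: "free_reduce (rev (map inv_letter w) @ w) = []"
proof (induction w)
  case (Cons a w)
  have "cancel_cons (inv_letter a) (cancel_cons a (free_reduce w)) = free_reduce w"
    using cancel_cons_inverse[OF reduced_free_reduce, of "inv_letter a" w] by simp
  then have "free_reduce (rev (map inv_letter (a # w)) @ a # w) =
      free_reduce (rev (map inv_letter w) @ free_reduce w)"
    using free_reduce_id[OF reduced_free_reduce, of w] by (simp add: free_reduce_def)
  then show ?case
    using Cons free_reduce_append_right by metis
qed (simp add: free_reduce_def)

lemma group_free_group: "group (free_group n)"
proof (rule groupI)
  fix u v assume "u \<in> carrier (free_group n)" "v \<in> carrier (free_group n)"
  then show "u \<otimes>\<^bsub>free_group n\<^esub> v \<in> carrier (free_group n)"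
    using set_free_reduce[of "u @ v"] reduced_free_reduce[of "u @ v"]
    by (fastforce simp: free_group_def in_lists_conv_set)
next
  show "\<one>\<^bsub>free_group n\<^esub> \<in> carrier (free_group n)"
    by (simp add: free_group_def reduced_def)
next
  fix u v w :: "(nat \<times> bool) list"
  show "u \<otimes>\<^bsub>free_group n\<^esub> v \<otimes>\<^bsub>free_group n\<^esub> w =
      u \<otimes>\<^bsub>free_group n\<^esub> (v \<otimes>\<^bsub>free_group n\<^esub> w)"
    by (simp add: free_group_def free_reduce_append_left free_reduce_append_right)
next
  fix u assume u: "u \<in> carrier (free_group n)"
  then show "\<one>\<^bsub>free_group n\<^esub> \<otimes>\<^bsub>free_group n\<^esub> u = u"
    by (simp add: free_group_def free_reduce_id)
  let ?v = "free_reduce (rev (map inv_letter u))"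
  have "set ?v \<subseteq> {..<n} \<times> UNIV"
    using u set_free_reduce[of "rev (map inv_letter u)"]
    by (fastforce simp: free_group_def in_lists_conv_set inv_letter_def)
  then have "?v \<in> carrier (free_group n)"
    using reduced_free_reduce by (auto simp: free_group_def)
  moreover have "?v \<otimes>\<^bsub>free_group n\<^esub> u = \<one>\<^bsub>free_group n\<^esub>"
    by (simp add: free_group_def free_reduce_append_left free_reduce_inverse)
  ultimately show "\<exists>v\<in>carrier (free_group n). v \<otimes>\<^bsub>free_group n\<^esub> u = \<one>\<^bsub>free_group n\<^esub>"
    by blast
qed

lemma finite_generating_set_free_basis: "finite_generating_set (free_group n) (free_basis n)"
proof -
  interpret group "free_group n" by (rule group_free_group)
  have basis: "free_basis n \<subseteq> carrier (free_group n)"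
    by (auto simp: free_basis_def free_group_def reduced_def)
  have letter: "[(i, b)] \<in> generate (free_group n) (free_basis n)" if "i < n" for i b
  proof -
    have pos: "[(i, True)] \<in> free_basis n"
      using that by (simp add: free_basis_def)
    have "inv\<^bsub>free_group n\<^esub> [(i, True)] = [(i, False)]"
      using that by (intro inv_equality)
        (auto simp: free_group_def free_reduce_def inv_letter_def reduced_def)
    then show ?thesis
      using generate.incl[OF pos, of "free_group n"] generate.inv[OF pos, of "free_group n"]
      by (cases b) simp_all
  qed
  have "w \<in> generate (free_group n) (free_basis n)" if "w \<in> carrier (free_group n)" for w
    using that
  proof (induction w)
    case Nil
    show ?case using generate.one[of "free_group n"] by (simp add: free_group_def)
  next
    case (Cons a w)
    obtain i b where a: "a = (i, b)" by (cases a)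
    have red: "reduced (a # w)" and i: "i < n" and w: "w \<in> carrier (free_group n)"
      using Cons.prems a by (auto simp: free_group_def reduced_def successively_Cons)
    have "[a] \<otimes>\<^bsub>free_group n\<^esub> w = a # w"
      using free_reduce_id[OF red] by (simp add: free_group_def)
    then show ?case
      using generate.eng[OF letter[OF i, of b] Cons.IH[OF w]] a by simp
  qed
  then show ?thesis
    using basis generate_incl[OF basis]
    by (auto simp: finite_generating_set_def free_basis_def)
qed


section \<open>Quasi-automorphisms and the group Hou\<close>

text \<open>A graph is given by its vertex set and its adjacency relation. \<open>Respecting\<close> an adjacency
  is understood in both directions: edges are mapped to edges and non-edges to non-edges.\<close>

definition quasi_automorphism :: "'v set \<Rightarrow> ('v \<times> 'v) set \<Rightarrow> ('v \<Rightarrow> 'v) \<Rightarrow> bool" where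
  "quasi_automorphism V E f \<longleftrightarrow> f \<in> Bij V \<and>
    finite {(u, v) \<in> V \<times> V. ((u, v) \<in> E) \<noteq> ((f u, f v) \<in> E)}"

text \<open>Edges come from right multiplication, so that left multiplication is an automorphism.\<close>

definition cayley_edges :: "('a, 'm) monoid_scheme \<Rightarrow> 'a set \<Rightarrow> ('a \<times> 'a) set" where
  "cayley_edges G S = {(u, v) \<in> carrier G \<times> carrier G.
    \<exists>x\<in>S. v = u \<otimes>\<^bsub>G\<^esub> x \<or> u = v \<otimes>\<^bsub>G\<^esub> x}"

definition Hou :: "('a, 'm) monoid_scheme \<Rightarrow> 'a set \<Rightarrow> ('a \<Rightarrow> 'a) monoid" where
  "Hou G S = (BijGroup (carrier G))\<lparr>carrier :=
    {f. quasi_automorphism (carrier G) (cayley_edges G S) f \<and>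
        (\<exists>g\<in>carrier G. finite {h \<in> carrier G. f h \<noteq> g \<otimes>\<^bsub>G\<^esub> h})}\<rparr>"

lemma mem_HouI:
  assumes "quasi_automorphism (carrier G) (cayley_edges G S) f" "g \<in> carrier G"
    and "finite {h \<in> carrier G. f h \<noteq> g \<otimes>\<^bsub>G\<^esub> h}"
  shows "f \<in> carrier (Hou G S)"
  using assms by (auto simp: Hou_def)

lemma quasi_automorphism_id: "quasi_automorphism V E (\<lambda>x\<in>V. x)"
proof -
  have eq: "{(u, v) \<in> V \<times> V. ((u, v) \<in> E) \<noteq> (((\<lambda>x\<in>V. x) u, (\<lambda>x\<in>V. x) v) \<in> E)} = {}"
    by auto
  show ?thesis
    unfolding quasi_automorphism_def eq using id_Bij by blast
qed

lemma quasi_automorphism_compose: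
  assumes f: "quasi_automorphism V E f" and g: "quasi_automorphism V E g"
  shows "quasi_automorphism V E (compose V f g)"
proof -
  let ?D = "\<lambda>f. {(u, v) \<in> V \<times> V. ((u, v) \<in> E) \<noteq> ((f u, f v) \<in> E)}"
  have bij: "bij_betw g V V" and fg: "f \<in> Bij V" "g \<in> Bij V" "finite (?D f)" "finite (?D g)"
    using f g by (auto simp: quasi_automorphism_def Bij_def)
  have "inj_on (map_prod g g) (V \<times> V)"
    using bij by (auto simp: inj_on_def bij_betw_def)
  then have "finite (map_prod g g -` ?D f \<inter> (V \<times> V))"
    by (rule finite_vimage_IntI[OF fg(3)])
  moreover have "?D (compose V f g) \<subseteq> ?D g \<union> (map_prod g g -` ?D f \<inter> (V \<times> V))"
    using bij by (auto simp: compose_def bij_betw_def)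
  ultimately have "finite (?D (compose V f g))"
    using finite_subset[OF _ finite_UnI[OF fg(4)]] by blast
  then show ?thesis
    using fg by (simp add: quasi_automorphism_def compose_Bij)
qed

lemma quasi_automorphism_inverse:
  assumes f: "quasi_automorphism V E f"
  shows "quasi_automorphism V E (\<lambda>x\<in>V. inv_into V f x)"
proof -
  let ?D = "\<lambda>f. {(u, v) \<in> V \<times> V. ((u, v) \<in> E) \<noteq> ((f u, f v) \<in> E)}"
  have bij: "bij_betw f V V" and B: "f \<in> Bij V" "finite (?D f)"
    using f by (auto simp: quasi_automorphism_def Bij_def)
  have inv: "inv_into V f u \<in> V" "f (inv_into V f u) = u" if "u \<in> V" for u
    using bij that by (auto simp: bij_betw_def f_inv_into_f inv_into_into)
  have "?D (\<lambda>x\<in>V. inv_into V f x) \<subseteq> map_prod f f ` ?D f"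
  proof clarify
    fix u v assume uv: "u \<in> V" "v \<in> V"
      and ne: "((u, v) \<in> E) \<noteq> (((\<lambda>x\<in>V. inv_into V f x) u, (\<lambda>x\<in>V. inv_into V f x) v) \<in> E)"
    show "(u, v) \<in> map_prod f f ` ?D f"
      using uv ne inv
      by (intro image_eqI[of _ _ "(inv_into V f u, inv_into V f v)"]) auto
  qed
  then have "finite (?D (\<lambda>x\<in>V. inv_into V f x))"
    by (rule finite_subset) (rule finite_imageI[OF B(2)])
  then show ?thesis
    using B by (simp add: quasi_automorphism_def restrict_inv_into_Bij)
qed

lemma group_Hou:
  assumes "group G"
  shows "group (Hou G S)"
proof -
  interpret G: group G by fact
  interpret B: group "BijGroup (carrier G)" by (rule group_BijGroup)
  let ?V = "carrier G" and ?E = "cayley_edges G S"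
  have Bij: "f \<in> Bij ?V" if "quasi_automorphism ?V ?E f" for f
    using that by (simp add: quasi_automorphism_def)
  have closed: "f h \<in> ?V" if "f \<in> Bij ?V" "h \<in> ?V" for f h
    using that by (auto simp: Bij_def bij_betw_def)
  have "subgroup (carrier (Hou G S)) (BijGroup ?V)"
  proof (rule B.subgroupI)
    show "carrier (Hou G S) \<subseteq> carrier (BijGroup ?V)"
      using Bij by (auto simp: Hou_def BijGroup_def)
    have "(\<lambda>h\<in>?V. h) \<in> carrier (Hou G S)"
    proof (rule mem_HouI[OF quasi_automorphism_id G.one_closed])
      have "{h \<in> ?V. (\<lambda>h\<in>?V. h) h \<noteq> \<one>\<^bsub>G\<^esub> \<otimes>\<^bsub>G\<^esub> h} = {}"
        by auto
      then show "finite {h \<in> ?V. (\<lambda>h\<in>?V. h) h \<noteq> \<one>\<^bsub>G\<^esub> \<otimes>\<^bsub>G\<^esub> h}"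
        by (metis finite.emptyI)
    qed
    then show "carrier (Hou G S) \<noteq> {}" by blast
  next
    fix f assume "f \<in> carrier (Hou G S)"
    then obtain g where f: "quasi_automorphism ?V ?E f" and g: "g \<in> ?V"
      and fin: "finite {h \<in> ?V. f h \<noteq> g \<otimes>\<^bsub>G\<^esub> h}"
      by (auto simp: Hou_def)
    let ?i = "\<lambda>h\<in>?V. inv_into ?V f h"
    have bij: "bij_betw f ?V ?V" using Bij[OF f] by (simp add: Bij_def)
    have i: "inv_into ?V f h \<in> ?V" "f (inv_into ?V f h) = h" if "h \<in> ?V" for h
      using bij that by (auto simp: bij_betw_def f_inv_into_f inv_into_into)
    have "{h \<in> ?V. ?i h \<noteq> inv\<^bsub>G\<^esub> g \<otimes>\<^bsub>G\<^esub> h} \<subseteq> f ` {h \<in> ?V. f h \<noteq> g \<otimes>\<^bsub>G\<^esub> h}"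
    proof clarify
      fix h assume h: "h \<in> ?V" and ne: "?i h \<noteq> inv\<^bsub>G\<^esub> g \<otimes>\<^bsub>G\<^esub> h"
      have "h \<noteq> g \<otimes>\<^bsub>G\<^esub> inv_into ?V f h"
        using ne h g i(1)[OF h] by (metis G.inv_solve_left restrict_apply')
      then show "h \<in> f ` {h \<in> ?V. f h \<noteq> g \<otimes>\<^bsub>G\<^esub> h}"
        using i[OF h] by (intro image_eqI[of _ _ "inv_into ?V f h"]) auto
    qed
    then have "finite {h \<in> ?V. ?i h \<noteq> inv\<^bsub>G\<^esub> g \<otimes>\<^bsub>G\<^esub> h}"
      by (rule finite_subset) (rule finite_imageI[OF fin])
    then have "?i \<in> carrier (Hou G S)"
      by (rule mem_HouI[OF quasi_automorphism_inverse[OF f] G.inv_closed[OF g]])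
    moreover have "inv\<^bsub>BijGroup ?V\<^esub> f = ?i"
      using Bij[OF f] by (rule inv_BijGroup)
    ultimately show "inv\<^bsub>BijGroup ?V\<^esub> f \<in> carrier (Hou G S)" by metis
  next
    fix f1 f2 assume "f1 \<in> carrier (Hou G S)" "f2 \<in> carrier (Hou G S)"
    then obtain g1 g2 where f: "quasi_automorphism ?V ?E f1" "quasi_automorphism ?V ?E f2"
      and g: "g1 \<in> ?V" "g2 \<in> ?V"
      and fin: "finite {h \<in> ?V. f1 h \<noteq> g1 \<otimes>\<^bsub>G\<^esub> h}" "finite {h \<in> ?V. f2 h \<noteq> g2 \<otimes>\<^bsub>G\<^esub> h}"
      by (auto simp: Hou_def)
    let ?c = "compose ?V f1 f2"
    let ?N = "f2 -` {h \<in> ?V. f1 h \<noteq> g1 \<otimes>\<^bsub>G\<^esub> h} \<inter> ?V"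
    have "inj_on f2 ?V" using Bij[OF f(2)] by (simp add: Bij_def bij_betw_def)
    then have "finite ?N" by (rule finite_vimage_IntI[OF fin(1)])
    note N = finite_UnI[OF fin(2) this]
    have "{h \<in> ?V. ?c h \<noteq> g1 \<otimes>\<^bsub>G\<^esub> g2 \<otimes>\<^bsub>G\<^esub> h} \<subseteq> {h \<in> ?V. f2 h \<noteq> g2 \<otimes>\<^bsub>G\<^esub> h} \<union> ?N"
    proof
      fix h assume "h \<in> {h \<in> ?V. ?c h \<noteq> g1 \<otimes>\<^bsub>G\<^esub> g2 \<otimes>\<^bsub>G\<^esub> h}"
      then have h: "h \<in> ?V" and ne: "f1 (f2 h) \<noteq> g1 \<otimes>\<^bsub>G\<^esub> (g2 \<otimes>\<^bsub>G\<^esub> h)"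
        using G.m_assoc[OF g] by (auto simp: compose_eq)
      have "f2 h \<in> ?V" by (rule closed[OF Bij[OF f(2)] h])
      then show "h \<in> {h \<in> ?V. f2 h \<noteq> g2 \<otimes>\<^bsub>G\<^esub> h} \<union> ?N"
        using h ne by (cases "f2 h = g2 \<otimes>\<^bsub>G\<^esub> h") simp_all
    qed
    then have "finite {h \<in> ?V. ?c h \<noteq> g1 \<otimes>\<^bsub>G\<^esub> g2 \<otimes>\<^bsub>G\<^esub> h}"
      by (rule finite_subset[OF _ N])
    then have "?c \<in> carrier (Hou G S)"
      by (rule mem_HouI[OF quasi_automorphism_compose[OF f] G.m_closed[OF g]])
    then show "f1 \<otimes>\<^bsub>BijGroup ?V\<^esub> f2 \<in> carrier (Hou G S)"
      using Bij f by (simp add: BijGroup_def)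
  qed
  then have "group (BijGroup ?V\<lparr>carrier := carrier (Hou G S)\<rparr>)"
    by (rule B.subgroup_imp_group)
  then show ?thesis by (simp add: Hou_def)
qed


section \<open>Semi-deterministic context-free languages\<close>

datatype 'a tape_symbol = Letter 'a | EndOfInput

datatype 'g stack_symbol = Symbol 'g | EndOfStack

text \<open>A transition yields the new state and the word that replaces the topmost stack symbol.
  The end-of-stack symbol is not stored: it is what is seen on the empty stack, it can neither be
  removed nor written, and a transition taken there pushes its word above it. The transition
  function is split into input-consuming moves and silent moves.\<close>

record ('q, 'a, 'g) dpda =
  states :: "'q set"
  stack_alphabet :: "'g set"
  init :: 'q
  finals :: "'q set"
  read_move :: "'q \<Rightarrow> 'a tape_symbol \<Rightarrow> 'g stack_symbol \<Rightarrow> ('q \<times> 'g list) option"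
  silent_move :: "'q \<Rightarrow> 'g stack_symbol \<Rightarrow> ('q \<times> 'g list) option"

definition wf_dpda :: "'a set \<Rightarrow> ('q, 'a, 'g) dpda \<Rightarrow> bool" where
  "wf_dpda A M \<longleftrightarrow>
    finite A \<and> finite (states M) \<and> finite (stack_alphabet M) \<and>
    init M \<in> states M \<and> finals M \<subseteq> states M \<and>
    (\<forall>q \<in> states M. \<forall>z \<in> insert EndOfStack (Symbol ` stack_alphabet M).
      (\<forall>a \<in> insert EndOfInput (Letter ` A). \<forall>q' s. read_move M q a z = Some (q', s) \<longrightarrow>
        q' \<in> states M \<and> s \<in> lists (stack_alphabet M)) \<and>
      (\<forall>q' s. silent_move M q z = Some (q', s) \<longrightarrow>
        q' \<in> states M \<and> s \<in> lists (stack_alphabet M)) \<and>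
      (silent_move M q z \<noteq> None \<longrightarrow>
        (\<forall>a \<in> insert EndOfInput (Letter ` A). read_move M q a z = None)))"

fun stack_top :: "'g list \<Rightarrow> 'g stack_symbol" where
  "stack_top [] = EndOfStack"
| "stack_top (z # s) = Symbol z"

inductive dpda_step :: "('q, 'a, 'g) dpda \<Rightarrow>
    'q \<times> 'a tape_symbol list \<times> 'g list \<Rightarrow> 'q \<times> 'a tape_symbol list \<times> 'g list \<Rightarrow> bool"
  for M where
  read: "read_move M q a (stack_top s) = Some (q', r) \<Longrightarrow>
    dpda_step M (q, a # w, s) (q', w, r @ tl s)"
| silent: "silent_move M q (stack_top s) = Some (q', r) \<Longrightarrow>
    dpda_step M (q, w, s) (q', w, r @ tl s)"

text \<open>The only nondeterminism is the choice of the initial stack content.\<close>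

definition semidet_language :: "'a set \<Rightarrow> ('q, 'a, 'g) dpda \<Rightarrow> 'a list set" where
  "semidet_language A M = {w \<in> lists A.
    \<exists>s \<in> lists (stack_alphabet M). \<exists>q \<in> finals M. \<exists>t.
      (dpda_step M)\<^sup>*\<^sup>* (init M, map Letter w @ [EndOfInput], s) (q, [], t)}"

text \<open>States and stack symbols range over finite sets, so taking them from \<open>nat\<close> is no loss.\<close>

definition semidet_context_free :: "'a set \<Rightarrow> 'a list set \<Rightarrow> bool" where
  "semidet_context_free A L \<longleftrightarrow>
    (\<exists>M :: (nat, 'a, nat) dpda. wf_dpda A M \<and> L = semidet_language A M)"

text \<open>The property of a co-word problem does not depend on the finite generating set; it is
  required for all of them, and one is required to exist.\<close>

definition coW_semidet_context_free :: "('a, 'm) monoid_scheme \<Rightarrow> bool" where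
  "coW_semidet_context_free G \<longleftrightarrow>
    (\<exists>S. finite_generating_set G S) \<and>
    (\<forall>S. finite_generating_set G S \<longrightarrow> semidet_context_free (S \<times> UNIV) (coW G S))"

end

theory Submission
  imports Defs "HOL-Combinatorics.Permutations"
begin

text \<open>Let \<open>H\<close> be the group in question and \<open>w = t\<^sub>1 \<dots> t\<^sub>k\<close> a word over its generators and their inverses.
Reading \<open>w\<close> from the left and applying \<open>t\<^sub>1\<inverse>\<close>, then \<open>t\<^sub>2\<inverse>\<close>, and so on, to a point \<open>p\<close> of the free
group \<open>F\<close> yields \<open>w\<inverse> p\<close>; so \<open>w\<close> is nontrivial iff some \<open>p\<close> is moved by this process
(\<open>coW_Hou\<close>). An automaton can guess \<open>p\<close> as a reduced word on its stack, with the first letter on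
top. Every \<open>t\<inverse>\<close> is left multiplication by some \<open>shift t\<close> except at finitely many points, so it
changes only a bounded top part of the stack. The difficulty is that \<open>p\<close> is forgotten on the way,
while the final point has to be compared with it.

The way out is to record the displacement of the point instead of \<open>p\<close> itself. Let \<open>\<gamma>\<close> be the product of
the shifts read so far, later ones on the left. Write the current point \<open>c\<close> as \<open>c = \<gamma> p d\<inverse>\<close>. Left multiplication does not
change \<open>d\<close>; at an exceptional point \<open>c\<close> the letter \<open>t\<close> changes \<open>d\<close> to \<open>defect t c \<cdot> d\<close>, where
\<open>defect t c\<close> measures how far \<open>t\<inverse>\<close> is from left multiplication at \<open>c\<close> (\<open>act_displacement\<close>). Since
\<open>F\<close> is infinite, \<open>w\<close> is nontrivial iff \<open>\<gamma> \<noteq> 1\<close> at the end, or \<open>d \<noteq> 1\<close> at the end for some \<open>p\<close>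
(\<open>moved_point_iff\<close>). The point is that \<open>d\<close> fits below \<open>c\<close> on the same stack, separated by a marker:
\<open>d\<close> changes only when \<open>c\<close> is short, and then the top of \<open>d\<close> is visible, and \<open>d\<close> too is
multiplied from the left. Whether \<open>d \<noteq> 1\<close> is kept in the state, and \<open>\<gamma>\<close> is
computed by a second mode of the same automaton, chosen by the initial stack
(\<open>accepts_Tracking\<close>, \<open>accepts_Approach\<close>, \<open>accepts_Far\<close>).

That \<open>H\<close> is finitely generated holds over every finitely generated group: a permutation with finite
support is a product of transpositions, and these are obtained from the transpositions of \<open>1\<close> with
a generator by conjugation with translations (\<open>finite_generating_set_Hou\<close>).\<close>

section \<open>Pushdown automata with bounded lookahead\<close>

text \<open>Finitely many states and stack symbols can be numbered, so the types of states and symbols of an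
automaton are irrelevant for the language class.\<close>

lemma semidet_language_relabel:
  fixes M :: "('q, 'a, 'g) dpda"
  assumes wf: "wf_dpda A M"
  shows "semidet_context_free A (semidet_language A M)"
proof -
  let ?Q = "states M" and ?Z = "stack_alphabet M"
  have fin: "finite A" "finite ?Q" "finite ?Z"
    and init: "init M \<in> ?Q" and finals: "finals M \<subseteq> ?Q"
    using wf unfolding wf_dpda_def by - (elim conjE, assumption)+
  obtain e :: "'q \<Rightarrow> nat" where e: "inj_on e ?Q"
    using finite_imp_inj_to_nat_seg[OF fin(2)] by blast
  obtain d :: "'g \<Rightarrow> nat" where d: "inj_on d ?Z"
    using finite_imp_inj_to_nat_seg[OF fin(3)] by blast
  define e' d' where "e' = inv_into ?Q e" and "d' = inv_into ?Z d"
  have e'e [simp]: "e' (e q) = q" if "q \<in> ?Q" for q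
    using e that by (simp add: e'_def)
  have d'd [simp]: "d' (d z) = z" if "z \<in> ?Z" for z
    using d that by (simp add: d'_def)
  define N :: "(nat, 'a, nat) dpda" where "N =
    \<lparr>states = e ` ?Q, stack_alphabet = d ` ?Z, init = e (init M), finals = e ` finals M,
     read_move = (\<lambda>q a z. map_option (map_prod e (map d)) (read_move M (e' q) a (map_stack_symbol d' z))),
     silent_move = (\<lambda>q z. map_option (map_prod e (map d)) (silent_move M (e' q) (map_stack_symbol d' z)))\<rparr>"
  have moves: "(\<forall>a \<in> insert EndOfInput (Letter ` A). \<forall>q' s. read_move M q a z = Some (q', s) \<longrightarrow>
        q' \<in> ?Q \<and> s \<in> lists ?Z) \<and>
      (\<forall>q' s. silent_move M q z = Some (q', s) \<longrightarrow> q' \<in> ?Q \<and> s \<in> lists ?Z) \<and>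
      (silent_move M q z \<noteq> None \<longrightarrow>
        (\<forall>a \<in> insert EndOfInput (Letter ` A). read_move M q a z = None))"
    if "q \<in> ?Q" "z \<in> insert EndOfStack (Symbol ` ?Z)" for q z
  proof -
    note conj = wf[unfolded wf_dpda_def]
    show ?thesis
      by (rule bspec[OF bspec[OF conj[THEN conjunct2, THEN conjunct2, THEN conjunct2, THEN conjunct2,
        THEN conjunct2] that(1)] that(2)])
  qed
  have read_closed: "q' \<in> ?Q \<and> r \<in> lists ?Z"
    if "q \<in> ?Q" "z \<in> insert EndOfStack (Symbol ` ?Z)" "a \<in> insert EndOfInput (Letter ` A)"
      "read_move M q a z = Some (q', r)" for q a z q' r
    using moves[OF that(1,2), THEN conjunct1, THEN bspec, OF that(3)] that(4) by blast
  have silent_closed: "q' \<in> ?Q \<and> r \<in> lists ?Z"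
    if "q \<in> ?Q" "z \<in> insert EndOfStack (Symbol ` ?Z)"
      "silent_move M q z = Some (q', r)" for q z q' r
    using moves[OF that(1,2), THEN conjunct2, THEN conjunct1] that(3) by blast
  have det: "read_move M q a z = None"
    if "q \<in> ?Q" "z \<in> insert EndOfStack (Symbol ` ?Z)" "a \<in> insert EndOfInput (Letter ` A)"
      "silent_move M q z \<noteq> None" for q a z
    by (rule moves[OF that(1,2), THEN conjunct2, THEN conjunct2, THEN mp, OF that(4), THEN bspec,
      OF that(3)])
  have wfN: "wf_dpda A N"
    unfolding wf_dpda_def
  proof (intro conjI ballI impI allI)
    show "finite A" "finite (states N)" "finite (stack_alphabet N)"
      "init N \<in> states N" "finals N \<subseteq> states N"
      using fin init finals by (auto simp: N_def)
  next
    fix q z a q' s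
    assume q: "q \<in> states N" and z: "z \<in> insert EndOfStack (Symbol ` stack_alphabet N)"
    have q': "e' q \<in> ?Q"
      using q by (auto simp: N_def)
    have z': "map_stack_symbol d' z \<in> insert EndOfStack (Symbol ` ?Z)"
      using z by (auto simp: N_def)
    { assume a: "a \<in> insert EndOfInput (Letter ` A)" and "read_move N q a z = Some (q', s)"
      then obtain p r where "read_move M (e' q) a (map_stack_symbol d' z) = Some (p, r)"
        and "q' = e p" "s = map d r"
        by (auto simp: N_def)
      then show "q' \<in> states N" "s \<in> lists (stack_alphabet N)"
        using read_closed[OF q' z' a] by (auto simp: N_def) }
    { assume "silent_move N q z = Some (q', s)"
      then obtain p r where "silent_move M (e' q) (map_stack_symbol d' z) = Some (p, r)"
        and "q' = e p" "s = map d r"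
        by (auto simp: N_def)
      then show "q' \<in> states N" "s \<in> lists (stack_alphabet N)"
        using silent_closed[OF q' z'] by (auto simp: N_def) }
    { assume "silent_move N q z \<noteq> None" and a: "a \<in> insert EndOfInput (Letter ` A)"
      then show "read_move N q a z = None"
        using det[OF q' z' a] by (auto simp: N_def) }
  qed
  \<comment> \<open>The decoding functions \<open>e'\<close> and \<open>d'\<close> are meaningful only on codes of actual states and symbols;
    the invariant \<open>ok\<close> keeps configurations inside that range.\<close>
  define ok where "ok = (\<lambda>(q, w, s). q \<in> ?Q \<and> w \<in> lists (insert EndOfInput (Letter ` A)) \<and> s \<in> lists ?Z)"
  define enc where "enc = (\<lambda>(q, w :: 'a tape_symbol list, s). (e q, w, map d s))"
  have map_d'd: "map d' (map d s) = s" if "s \<in> lists ?Z" for s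
    using that by (induction s) auto
  have top: "stack_top s \<in> insert EndOfStack (Symbol ` ?Z)"
    "map_stack_symbol d' (stack_top (map d s)) = stack_top s" if "s \<in> lists ?Z" for s
    using that by (cases s; auto)+
  have ok_step: "ok c'" if "dpda_step M c c'" "ok c" for c c'
    using that
  proof cases
    case (read q a s q' r w)
    then show ?thesis
      using that(2) read_closed[of q "stack_top s" a q' r] top(1)[of s]
      by (cases s) (auto simp: ok_def)
  next
    case (silent q s q' r w)
    then show ?thesis
      using that(2) silent_closed[of q "stack_top s" q' r] top(1)[of s]
      by (cases s) (auto simp: ok_def)
  qed
  have forward: "dpda_step N (enc c) (enc c')" if "dpda_step M c c'" "ok c" for c c'
    using that
  proof cases
    case (read q a s q' r w)
    then show ?thesis
      using that(2) top(2)[of s] dpda_step.read[of N "e q" a "map d s" "e q'" "map d r" w]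
      by (simp add: ok_def enc_def N_def map_tl)
  next
    case (silent q s q' r w)
    then show ?thesis
      using that(2) top(2)[of s] dpda_step.silent[of N "e q" "map d s" "e q'" "map d r" w]
      by (simp add: ok_def enc_def N_def map_tl)
  qed
  have backward: "\<exists>c'. x = enc c' \<and> dpda_step M c c'" if "dpda_step N (enc c) x" "ok c" for c x
  proof -
    obtain q w s where c: "c = (q, w, s)" by (cases c)
    have mem: "q \<in> ?Q" "s \<in> lists ?Z" using that(2) c by (auto simp: ok_def)
    from that(1) show ?thesis
    proof cases
      case (read q1 a s1 q1' r1 w1)
      then obtain q' r where "read_move M q a (stack_top s) = Some (q', r)" "q1' = e q'" "r1 = map d r"
        using c mem top(2)[OF mem(2)] by (auto simp: enc_def N_def)
      then show ?thesis
        using read c dpda_step.read[of M q a s q' r w1]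
        by (intro exI[of _ "(q', w1, r @ tl s)"]) (auto simp: enc_def map_tl)
    next
      case (silent q1 s1 q1' r1 w1)
      then obtain q' r where "silent_move M q (stack_top s) = Some (q', r)" "q1' = e q'" "r1 = map d r"
        using c mem top(2)[OF mem(2)] by (auto simp: enc_def N_def)
      then show ?thesis
        using silent c dpda_step.silent[of M q s q' r w]
        by (intro exI[of _ "(q', w, r @ tl s)"]) (auto simp: enc_def map_tl)
    qed
  qed
  have ok_steps: "ok c'" if "(dpda_step M)\<^sup>*\<^sup>* c c'" "ok c" for c c'
    using that by (induction rule: rtranclp_induct) (auto intro: ok_step)
  have forwards: "(dpda_step N)\<^sup>*\<^sup>* (enc c) (enc c')" if "(dpda_step M)\<^sup>*\<^sup>* c c'" "ok c" for c c'
    using that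
  proof (induction rule: rtranclp_induct)
    case (step c1 c2)
    then show ?case
      using forward ok_steps by (meson rtranclp.rtrancl_into_rtrancl)
  qed simp
  have backwards: "\<exists>c'. x = enc c' \<and> (dpda_step M)\<^sup>*\<^sup>* c c'" if "(dpda_step N)\<^sup>*\<^sup>* (enc c) x" "ok c" for c x
    using that
  proof (induction rule: rtranclp_induct)
    case (step x y)
    then obtain c' where c': "x = enc c'" "(dpda_step M)\<^sup>*\<^sup>* c c'"
      by blast
    then obtain c'' where "y = enc c''" "dpda_step M c' c''"
      using backward[OF _ ok_steps[OF c'(2) step.prems]] step.hyps(2) by blast
    then show ?case
      using rtranclp.rtrancl_into_rtrancl[OF c'(2)] by blast
  qed blast
  have start: "ok (init M, map Letter w @ [EndOfInput], s)" if "w \<in> lists A" "s \<in> lists ?Z" for w s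
    using that init by (auto simp: ok_def)
  have "semidet_language A M = semidet_language A N"
  proof (intro equalityI subsetI)
    fix w assume "w \<in> semidet_language A M"
    then obtain s q t where w: "w \<in> lists A" and s: "s \<in> lists ?Z" and q: "q \<in> finals M"
      and run: "(dpda_step M)\<^sup>*\<^sup>* (init M, map Letter w @ [EndOfInput], s) (q, [], t)"
      by (auto simp: semidet_language_def)
    have "(dpda_step N)\<^sup>*\<^sup>* (init N, map Letter w @ [EndOfInput], map d s) (e q, [], map d t)"
      using forwards[OF run start[OF w s]] by (simp add: enc_def N_def)
    moreover have "map d s \<in> lists (stack_alphabet N)" "e q \<in> finals N"
      using s q by (auto simp: N_def)
    ultimately show "w \<in> semidet_language A N"
      using w unfolding semidet_language_def by blast
  next
    fix w assume "w \<in> semidet_language A N"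
    then obtain s q t where w: "w \<in> lists A" and s: "s \<in> lists (d ` ?Z)" and q: "q \<in> e ` finals M"
      and run: "(dpda_step N)\<^sup>*\<^sup>* (e (init M), map Letter w @ [EndOfInput], s) (q, [], t)"
      by (auto simp: semidet_language_def N_def)
    obtain s0 where s0: "s = map d s0" "s0 \<in> lists ?Z"
      using s by (metis imageE lists_image)
    obtain c' where c': "(q, [], t) = enc c'"
      "(dpda_step M)\<^sup>*\<^sup>* (init M, map Letter w @ [EndOfInput], s0) c'"
      using backwards[OF _ start[OF w s0(2)]] run s0(1) by (fastforce simp: enc_def)
    obtain q0 t0 where q0: "c' = (q0, [], t0)" "q = e q0"
      using c'(1) by (cases c') (auto simp: enc_def)
    have "q0 \<in> ?Q"
      using ok_steps[OF c'(2) start[OF w s0(2)]] q0 by (simp add: ok_def)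
    then have "q0 \<in> finals M"
      using q q0(2) finals inj_on_image_mem_iff[OF e, of q0 "finals M"] by simp
    then show "w \<in> semidet_language A M"
      using w s0(2) c'(2) q0(1) unfolding semidet_language_def by blast
  qed
  then show ?thesis
    using wfN by (auto simp: semidet_context_free_def)
qed

text \<open>It is convenient to program machines that see the topmost \<open>K\<close> stack symbols at once and replace all
of them in one step; a shorter view reveals that it is the whole stack. There are no silent moves, so
a run is a function of the initial stack.\<close>

type_synonym ('q, 'a, 'g) lookahead_move =
  "'q \<Rightarrow> 'a tape_symbol \<Rightarrow> 'g list \<Rightarrow> ('q \<times> 'g list) option"

fun lookahead_run :: "('q, 'a, 'g) lookahead_move \<Rightarrow> nat \<Rightarrow>
    'q \<Rightarrow> 'g list \<Rightarrow> 'a tape_symbol list \<Rightarrow> ('q \<times> 'g list) option" where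
  "lookahead_run T K q s [] = Some (q, s)"
| "lookahead_run T K q s (a # w) =
    (case T q a (take K s) of None \<Rightarrow> None
     | Some (q', r) \<Rightarrow> lookahead_run T K q' (r @ drop K s) w)"

definition lookahead_language :: "'a set \<Rightarrow> 'g set \<Rightarrow> ('q, 'a, 'g) lookahead_move \<Rightarrow> nat \<Rightarrow>
    'q \<Rightarrow> 'q \<Rightarrow> 'a list set" where
  "lookahead_language A Z T K q\<^sub>0 q\<^sub>f = {w \<in> lists A. \<exists>s \<in> lists Z. \<exists>t.
    lookahead_run T K q\<^sub>0 s (map Letter w @ [EndOfInput]) = Some (q\<^sub>f, t)}"

text \<open>An ordinary automaton simulates the lookahead by popping the top of the stack silently into a buffer
that is part of its finite state. It reads the next letter when the buffer holds \<open>K\<close> symbols or the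
end of the stack is seen.\<close>

theorem semidet_context_free_lookahead:
  fixes T :: "('q, 'a, 'g) lookahead_move"
  assumes fin: "finite A" "finite Q" "finite Z" and q: "q\<^sub>0 \<in> Q" "q\<^sub>f \<in> Q"
    and closed: "\<And>q a x q' r. \<lbrakk>q \<in> Q; a \<in> insert EndOfInput (Letter ` A); x \<in> lists Z;
      T q a x = Some (q', r)\<rbrakk> \<Longrightarrow> q' \<in> Q \<and> r \<in> lists Z"
  shows "semidet_context_free A (lookahead_language A Z T K q\<^sub>0 q\<^sub>f)"
proof -
  define B where "B = {b. set b \<subseteq> Z \<and> length b \<le> K}"
  define M :: "('q \<times> 'g list, 'a, 'g) dpda" where "M =
    \<lparr>states = Q \<times> B, stack_alphabet = Z, init = (q\<^sub>0, []), finals = {q\<^sub>f} \<times> B,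
     read_move = (\<lambda>(q, b) a z. if length b = K \<or> z = EndOfStack then
         \<comment> \<open>A move replaces the visible symbol, which lies below the buffer, so it is written back.\<close>
         (case T q a b of None \<Rightarrow> None
          | Some (q', r) \<Rightarrow> Some ((q', []), r @ (case z of EndOfStack \<Rightarrow> [] | Symbol g \<Rightarrow> [g])))
       else None),
     silent_move = (\<lambda>(q, b) z. case z of EndOfStack \<Rightarrow> None
       | Symbol g \<Rightarrow> if length b < K then Some ((q, b @ [g]), []) else None)\<rparr>"
  have "finite B"
    unfolding B_def by (rule finite_lists_length_le[OF fin(3)])
  have wf: "wf_dpda A M"
    unfolding wf_dpda_def
  proof (intro conjI ballI impI allI)
    show "finite A" "finite (states M)" "finite (stack_alphabet M)"
      "init M \<in> states M" "finals M \<subseteq> states M"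
      using fin \<open>finite B\<close> q by (auto simp: M_def B_def)
  next
    fix p z a p' s
    assume p: "p \<in> states M" and z: "z \<in> insert EndOfStack (Symbol ` stack_alphabet M)"
    obtain q b where qb: "p = (q, b)" "q \<in> Q" "b \<in> lists Z" "length b \<le> K"
      using p by (auto simp: M_def B_def)
    { assume "a \<in> insert EndOfInput (Letter ` A)" "read_move M p a z = Some (p', s)"
      then show "p' \<in> states M" "s \<in> lists (stack_alphabet M)"
        using qb z closed[of q a b]
        by (auto simp: M_def B_def split: if_splits option.splits stack_symbol.splits) }
    { assume "silent_move M p z = Some (p', s)"
      then show "p' \<in> states M" "s \<in> lists (stack_alphabet M)"
        using qb z by (auto simp: M_def B_def split: if_splits stack_symbol.splits) }
    { assume "silent_move M p z \<noteq> None"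
      then show "read_move M p a z = None"
        using qb by (auto simp: M_def split: if_splits stack_symbol.splits) }
  qed
  have fill: "(dpda_step M)\<^sup>*\<^sup>* ((q, []), w, s) ((q, take j s), w, drop j s)" if "j \<le> K" for q w s j
    using that
  proof (induction j)
    case (Suc j)
    show ?case
    proof (cases "j < length s")
      case True
      then have "silent_move M (q, take j s) (stack_top (drop j s)) = Some ((q, take (Suc j) s), [])"
        using Suc.prems by (simp add: M_def take_Suc_conv_app_nth flip: Cons_nth_drop_Suc)
      from dpda_step.silent[OF this, of w]
      show ?thesis
        using Suc by (simp add: drop_Suc tl_drop rtranclp.rtrancl_into_rtrancl)
    next
      case False
      then show ?thesis using Suc by simp
    qed
  qed simp
  have complete: "(dpda_step M)\<^sup>*\<^sup>* ((q, []), w, s) ((q', []), [], t)"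
    if "lookahead_run T K q s w = Some (q', t)" for q w s q' t
    using that
  proof (induction w arbitrary: q s)
    case (Cons a w)
    then obtain q1 r where T: "T q a (take K s) = Some (q1, r)"
      and rest: "lookahead_run T K q1 (r @ drop K s) w = Some (q', t)"
      by (auto split: option.splits)
    let ?r = "r @ take 1 (drop K s)"
    have "read_move M (q, take K s) a (stack_top (drop K s)) = Some ((q1, []), ?r)"
      using T by (cases "K < length s"; cases "drop K s") (auto simp: M_def)
    from dpda_step.read[OF this, of w]
    have "dpda_step M ((q, take K s), a # w, drop K s) ((q1, []), w, r @ drop K s)"
      by (cases "drop K s") auto
    then show ?case
      using fill[of K q "a # w" s] Cons.IH[OF rest] by (simp add: rtranclp_trans)
  qed simp
  have sound: "\<exists>t'. lookahead_run T K (fst p) (snd p @ s) w = Some (fst p', t')"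
    if "(dpda_step M)\<^sup>*\<^sup>* (p, w, s) (p', [], t)" "length (snd p) \<le> K" for p w s p' t
    using that
  proof (induction "(p, w, s)" arbitrary: p w s rule: converse_rtranclp_induct)
    case base
    then show ?case by simp
  next
    case (step c)
    from step(1) show ?case
    proof cases
      case (read a q1 r w1)
      then have "length (snd p) = K \<or> s = []"
        by (cases s) (auto simp: M_def split: if_splits prod.splits)
      then have "take K (snd p @ s) = snd p" "drop K (snd p @ s) = s"
        using step.prems by auto
      moreover obtain q1' r' where "T (fst p) a (snd p) = Some (q1', r')" "q1 = (q1', [])"
        "r @ tl s = r' @ s"
        using read
        by (cases s) (auto simp: M_def split: if_splits prod.splits option.splits)
      ultimately show ?thesis
        using step(3)[of q1 w1 "r @ tl s"] read by simp
    next
      case (silent q1 r)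
      then obtain z s' where "s = z # s'" "q1 = (fst p, snd p @ [z])" "r = []" "length (snd p) < K"
        by (cases s) (auto simp: M_def split: if_splits prod.splits)
      then show ?thesis
        using step(3)[of q1 w "r @ tl s"] silent by simp
    qed
  qed
  have "lookahead_language A Z T K q\<^sub>0 q\<^sub>f = semidet_language A M"
  proof (intro equalityI subsetI)
    fix w assume "w \<in> lookahead_language A Z T K q\<^sub>0 q\<^sub>f"
    then obtain s t where w: "w \<in> lists A" and s: "s \<in> lists Z"
      and "lookahead_run T K q\<^sub>0 s (map Letter w @ [EndOfInput]) = Some (q\<^sub>f, t)"
      by (auto simp: lookahead_language_def)
    from complete[OF this(3)]
    have "(dpda_step M)\<^sup>*\<^sup>* (init M, map Letter w @ [EndOfInput], s) ((q\<^sub>f, []), [], t)"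
      by (simp add: M_def)
    moreover have "(q\<^sub>f, []) \<in> finals M" "s \<in> lists (stack_alphabet M)"
      using s by (auto simp: M_def B_def)
    ultimately show "w \<in> semidet_language A M"
      using w unfolding semidet_language_def by blast
  next
    fix w assume "w \<in> semidet_language A M"
    then obtain s p t where w: "w \<in> lists A" and s: "s \<in> lists Z" and p: "p \<in> {q\<^sub>f} \<times> B"
      and run: "(dpda_step M)\<^sup>*\<^sup>* ((q\<^sub>0, []), map Letter w @ [EndOfInput], s) (p, [], t)"
      by (auto simp: semidet_language_def M_def)
    have "\<exists>t. lookahead_run T K q\<^sub>0 s (map Letter w @ [EndOfInput]) = Some (q\<^sub>f, t)"
      using sound[OF run] p by auto
    then show "w \<in> lookahead_language A Z T K q\<^sub>0 q\<^sub>f"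
      using w s unfolding lookahead_language_def by blast
  qed
  then show ?thesis
    using semidet_language_relabel[OF wf] by simp
qed

section \<open>Left multiplication on the stack\<close>

lemma free_group_mult:
  assumes "v \<in> carrier (free_group n)"
  shows "u \<otimes>\<^bsub>free_group n\<^esub> v = foldr cancel_cons u v"
  using assms free_reduce_id[of v] by (simp add: free_group_def free_reduce_def)

lemma length_foldr_cancel_cons: "length v \<le> length u + length (foldr cancel_cons u v)"
proof (induction u)
  case (Cons a u)
  then show ?case by (cases "foldr cancel_cons u v") auto
qed simp

text \<open>A stack consists of letters \<open>Some a\<close> and markers \<open>None\<close>. Multiplication from the left acts on
the word above the topmost marker and also makes sense when that word is not reduced, as may happen
for a guessed initial stack.\<close>

fun stack_push :: "'a \<times> bool \<Rightarrow> ('a \<times> bool) option list \<Rightarrow> ('a \<times> bool) option list" where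
  "stack_push a (Some b # s) = (if b = inv_letter a then s else Some a # Some b # s)"
| "stack_push a s = Some a # s"

definition stack_mult where
  "stack_mult u s = foldr stack_push u s"

lemma stack_mult_map: "stack_mult u (map Some v) = map Some (foldr cancel_cons u v)"
  unfolding stack_mult_def
proof (induction u)
  case (Cons a u)
  then show ?case by (cases "foldr cancel_cons u v") auto
qed simp

lemma stack_mult_map_None:
  "stack_mult u (map Some v @ None # s) = map Some (foldr cancel_cons u v) @ None # s"
  unfolding stack_mult_def
proof (induction u)
  case (Cons a u)
  then show ?case by (cases "foldr cancel_cons u v") auto
qed simp

lemma set_stack_mult: "set (stack_mult u s) \<subseteq> Some ` set u \<union> set s"
proof (induction u)
  case (Cons a u)
  have "set (stack_push a t) \<subseteq> insert (Some a) (set t)" for t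
    by (cases "(a, t)" rule: stack_push.cases) auto
  then show ?case
    using Cons by (fastforce simp: stack_mult_def)
qed (simp add: stack_mult_def)

lemma length_stack_mult: "length s \<le> length u + length (stack_mult u s)"
proof (induction u)
  case (Cons a u)
  have "length t \<le> Suc (length (stack_push a t))" for t
    by (cases "(a, t)" rule: stack_push.cases) auto
  from this[of "stack_mult u s"] show ?case
    using Cons by (simp add: stack_mult_def)
qed (simp add: stack_mult_def)

text \<open>Each letter of \<open>u\<close> cancels at most one stack symbol. Hence the symbols below the first \<open>length u\<close> ones
are not inspected, which is why bounded lookahead suffices.\<close>

lemma stack_mult_append:
  "length u \<le> length s \<Longrightarrow> stack_mult u (s @ t) = stack_mult u s @ t"
proof (induction u)
  case (Cons a u)
  have push: "stack_push a (x @ t) = stack_push a x @ t" if "x \<noteq> []" for x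
    using that by (cases "(a, x)" rule: stack_push.cases) auto
  have "stack_mult u s \<noteq> []"
    using length_stack_mult[of s u] Cons.prems by auto
  from push[OF this] show ?case
    using Cons by (simp add: stack_mult_def)
qed (simp add: stack_mult_def)

lemma stack_mult_take_drop:
  assumes "length u \<le> K"
  shows "stack_mult u (take K s) @ drop K s = stack_mult u s"
proof (cases "K \<le> length s")
  case True
  then show ?thesis
    using stack_mult_append[of u "take K s" "drop K s"] assms by simp
qed simp

section \<open>Almost translations of a free group\<close>

text \<open>\<open>Far\<close>: the stack holds the product of the shifts above a marker. \<open>Approach\<close>: the stack is the current
point, which has been multiplied only from the left so far. \<open>Tracking b\<close>: the stack is the current point,
a marker, and the displacement, and \<open>b\<close> tells whether the displacement is nontrivial. The state
\<open>Start\<close> serves only to look at the guessed stack and choose between \<open>Far\<close> and \<open>Approach\<close>.\<close>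

datatype phase = Start | Far | Approach | Tracking bool | Accept

text \<open>Letters act on the free group such that each agrees with left multiplication by its shift on all
words longer than \<open>L\<close>. Treating all short words as exceptional makes the exceptional points
recognizable by their length alone.\<close>

locale almost_translation_action =
  fixes n :: nat and A :: "'a set" and act :: "'a \<Rightarrow> (nat \<times> bool) list \<Rightarrow> (nat \<times> bool) list"
    and shift :: "'a \<Rightarrow> (nat \<times> bool) list" and L :: nat
  assumes rank: "n \<ge> 1" and finite_A: "finite A"
    and act_closed: "\<lbrakk>a \<in> A; c \<in> carrier (free_group n)\<rbrakk> \<Longrightarrow> act a c \<in> carrier (free_group n)"
    and shift_closed: "a \<in> A \<Longrightarrow> shift a \<in> carrier (free_group n)"
    and act_far: "\<lbrakk>a \<in> A; c \<in> carrier (free_group n); length c > L\<rbrakk>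
      \<Longrightarrow> act a c = shift a \<otimes>\<^bsub>free_group n\<^esub> c"
begin

abbreviation "F \<equiv> free_group n"

sublocale F: group "free_group n"
  by (rule group_free_group)

lemma one_F [simp]: "\<one>\<^bsub>F\<^esub> = []"
  by (simp add: free_group_def)

lemmas F_one [simp] = F.l_one[unfolded one_F] F.r_one[unfolded one_F] F.one_closed[unfolded one_F]

lemma stack_mult_free_group:
  "c \<in> carrier F \<Longrightarrow> stack_mult u (map Some c) = map Some (u \<otimes>\<^bsub>F\<^esub> c)"
  "c \<in> carrier F \<Longrightarrow>
    stack_mult u (map Some c @ None # s) = map Some (u \<otimes>\<^bsub>F\<^esub> c) @ None # s"
  by (simp_all add: stack_mult_map stack_mult_map_None free_group_mult)

text \<open>The right factor by which the action of a letter falls short of left multiplication by its shift: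
\<open>shift a \<cdot> c = act a c \<cdot> defect a c\<close>.\<close>

definition defect where
  "defect a c = inv\<^bsub>F\<^esub> (act a c) \<otimes>\<^bsub>F\<^esub> (shift a \<otimes>\<^bsub>F\<^esub> c)"

lemma defect_closed: "\<lbrakk>a \<in> A; c \<in> carrier F\<rbrakk> \<Longrightarrow> defect a c \<in> carrier F"
  by (simp add: defect_def act_closed shift_closed)

lemma act_defect:
  "\<lbrakk>a \<in> A; c \<in> carrier F\<rbrakk> \<Longrightarrow> act a c \<otimes>\<^bsub>F\<^esub> defect a c = shift a \<otimes>\<^bsub>F\<^esub> c"
  by (simp add: defect_def act_closed shift_closed F.m_assoc[symmetric])

lemma defect_far: "\<lbrakk>a \<in> A; c \<in> carrier F; length c > L\<rbrakk> \<Longrightarrow> defect a c = []"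
  by (simp add: defect_def act_far shift_closed)

text \<open>The displacement starts from \<open>d\<close> and collects the defects along the path of the point \<open>c\<close>. Later
defects are multiplied on the left, so a stack can hold it.\<close>

primrec displacement where
  "displacement [] c d = d"
| "displacement (a # w) c d = displacement w (act a c) (defect a c \<otimes>\<^bsub>F\<^esub> d)"

abbreviation "shifts \<equiv> fold (\<lambda>a u. shift a \<otimes>\<^bsub>F\<^esub> u)"

lemma shifts_closed: "\<lbrakk>w \<in> lists A; u \<in> carrier F\<rbrakk> \<Longrightarrow> shifts w u \<in> carrier F"
  by (induction w arbitrary: u) (auto simp: shift_closed)

lemma shifts_mult:
  "\<lbrakk>w \<in> lists A; u \<in> carrier F; v \<in> carrier F\<rbrakk>
    \<Longrightarrow> shifts w (u \<otimes>\<^bsub>F\<^esub> v) = shifts w u \<otimes>\<^bsub>F\<^esub> v"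
  by (induction w arbitrary: u) (auto simp: shift_closed F.m_assoc[symmetric])

lemma fold_act_closed: "\<lbrakk>w \<in> lists A; c \<in> carrier F\<rbrakk> \<Longrightarrow> fold act w c \<in> carrier F"
  by (induction w arbitrary: c) (auto simp: act_closed)

lemma displacement_closed:
  "\<lbrakk>w \<in> lists A; c \<in> carrier F; d \<in> carrier F\<rbrakk> \<Longrightarrow> displacement w c d \<in> carrier F"
  by (induction w arbitrary: c d) (auto simp: act_closed defect_closed)

text \<open>The product of the current point and the displacement is subject to left
multiplication by the shifts only: the defects are chosen to make this invariant hold.\<close>

lemma act_displacement:
  "\<lbrakk>w \<in> lists A; c \<in> carrier F; d \<in> carrier F\<rbrakk>
    \<Longrightarrow> fold act w c \<otimes>\<^bsub>F\<^esub> displacement w c d = shifts w (c \<otimes>\<^bsub>F\<^esub> d)"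
proof (induction w arbitrary: c d)
  case (Cons a w)
  then have "act a c \<otimes>\<^bsub>F\<^esub> (defect a c \<otimes>\<^bsub>F\<^esub> d) = shift a \<otimes>\<^bsub>F\<^esub> (c \<otimes>\<^bsub>F\<^esub> d)"
    by (simp add: act_defect act_closed shift_closed defect_closed F.m_assoc[symmetric])
  then show ?case
    using Cons by (simp add: act_closed defect_closed)
qed simp

definition "near = {c \<in> carrier F. length c \<le> L}"

text \<open>The lookahead has to exceed every shift and, below a point of length at most \<open>L\<close> and the marker,
every defect, in both cases strictly. At least one untouched symbol then stays in view: below a short
point this shows whether the displacement becomes empty, and for a guessed stack it leaves the
junction with the unseen part intact.\<close>

definition "K = L + 2 + Max (insert 0 (length ` (shift ` A \<union> case_prod defect ` (A \<times> near))))"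

lemma finite_near: "finite near"
proof (rule finite_subset)
  show "near \<subseteq> {c. set c \<subseteq> {..<n} \<times> UNIV \<and> length c \<le> L}"
    by (auto simp: near_def free_group_def in_lists_conv_set)
  show "finite {c. set c \<subseteq> {..<n} \<times> (UNIV :: bool set) \<and> length c \<le> L}"
    by (rule finite_lists_length_le) simp
qed

lemma length_le_K:
  assumes "x \<in> shift ` A \<union> case_prod defect ` (A \<times> near)"
  shows "L + 2 + length x \<le> K"
proof -
  have "length x \<le> Max (insert 0 (length ` (shift ` A \<union> case_prod defect ` (A \<times> near))))"
    using assms finite_A finite_near by (intro Max_ge) auto
  then show ?thesis by (simp add: K_def)
qed

lemma shift_le_K: "a \<in> A \<Longrightarrow> L + 2 + length (shift a) \<le> K"
  by (intro length_le_K) auto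

lemma defect_le_K: "\<lbrakk>a \<in> A; c \<in> carrier F; length c \<le> L\<rbrakk> \<Longrightarrow> L + 2 + length (defect a c) \<le> K"
  by (intro length_le_K) (auto simp: near_def)

lemma K_gt_L: "L + 2 \<le> K"
  by (simp add: K_def)

lemma fold_act_far:
  "\<lbrakk>w \<in> lists A; c \<in> carrier F; length c > L + K * length w\<rbrakk> \<Longrightarrow> fold act w c = shifts w c"
proof (induction w arbitrary: c)
  case (Cons a w)
  then have a: "a \<in> A" by simp
  have "length c \<le> length (shift a) + length (shift a \<otimes>\<^bsub>F\<^esub> c)"
    using length_foldr_cancel_cons[of c "shift a"] Cons.prems by (simp add: free_group_mult)
  then have "length (shift a \<otimes>\<^bsub>F\<^esub> c) > L + K * length w"
    using Cons.prems shift_le_K[OF a] by simp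
  then show ?case
    using Cons a by (simp add: act_far shift_closed)
qed simp

text \<open>If the shifts multiply to \<open>1\<close>, the invariant says that a point is moved iff its displacement is
nontrivial. If they do not, a point so long that it never meets an exception is moved by the product
of the shifts; this is where the free group has to be infinite.\<close>

lemma moved_point_iff:
  assumes w: "w \<in> lists A"
  shows "(\<exists>p\<in>carrier F. fold act w p \<noteq> p) \<longleftrightarrow>
    shifts w [] \<noteq> [] \<or> (\<exists>p\<in>carrier F. displacement w p [] \<noteq> [])"
proof -
  have shifts: "shifts w p = shifts w [] \<otimes>\<^bsub>F\<^esub> p" if "p \<in> carrier F" for p
    using shifts_mult[OF w _ that, of "[]"] that by simp
  have eq: "fold act w p \<otimes>\<^bsub>F\<^esub> displacement w p [] = shifts w [] \<otimes>\<^bsub>F\<^esub> p" if "p \<in> carrier F" for p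
    using act_displacement[OF w that, of "[]"] shifts[OF that] that by simp
  show ?thesis
  proof (intro iffI; rule ccontr)
    assume "\<exists>p\<in>carrier F. fold act w p \<noteq> p"
      and "\<not> (shifts w [] \<noteq> [] \<or> (\<exists>p\<in>carrier F. displacement w p [] \<noteq> []))"
    then show False
      using eq fold_act_closed[OF w] by force
  next
    assume *: "shifts w [] \<noteq> [] \<or> (\<exists>p\<in>carrier F. displacement w p [] \<noteq> [])"
      and fixed: "\<not> (\<exists>p\<in>carrier F. fold act w p \<noteq> p)"
    define p where "p = replicate (Suc (L + K * length w)) (0 :: nat, True)"
    have "successively (\<lambda>a b. b \<noteq> inv_letter a) (replicate m (0 :: nat, True))" for m
      by (induction m) (auto simp: successively_Cons inv_letter_def)
    then have p: "p \<in> carrier F"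
      using rank by (auto simp: p_def free_group_def reduced_def simp del: replicate_Suc)
    have far: "fold act w p = shifts w p"
      using p by (intro fold_act_far[OF w]) (auto simp: p_def)
    have "fold act w p = p"
      using fixed p by blast
    then have "shifts w [] \<otimes>\<^bsub>F\<^esub> p = [] \<otimes>\<^bsub>F\<^esub> p"
      unfolding shifts[OF p, symmetric] far[symmetric] by (simp add: p)
    then have shift: "shifts w [] = []"
      by (simp add: F.right_cancel p shifts_closed[OF w])
    have "displacement w q [] = []" if "q \<in> carrier F" for q
    proof -
      have "q \<otimes>\<^bsub>F\<^esub> displacement w q [] = q \<otimes>\<^bsub>F\<^esub> []"
        using eq[OF that] fixed that by (simp add: shift)
      then show ?thesis
        by (simp add: that displacement_closed[OF w that])
    qed
    then show False using * shift by blast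
  qed
qed

section \<open>The automaton\<close>

text \<open>The guessed point may be any stack content. The machine gets stuck once the visible part is not a
reduced word; a short view shows the whole stack, so tracking never begins from a
malformed guess. When tracking begins, the displacement is the first defect.\<close>

definition approach_move where
  "approach_move a x =
    (if x \<in> map Some ` carrier F then
       let c = map the x in
       if length c \<le> L
       then Some (Tracking (defect a c \<noteq> []), map Some (act a c) @ None # map Some (defect a c))
       else Some (Approach, stack_mult (shift a) x)
     else None)"

text \<open>The visible part of the point is what precedes the marker. While tracking, the stack has a marker, so a
view that does not show it consists of more than \<open>L\<close> letters of the point.\<close>

definition tracking_move where
  "tracking_move b a x =
    (let c = map the (takeWhile (\<lambda>z. z \<noteq> None) x) in
     if c \<notin> carrier F then None
     else if length c \<le> L then
       let d = stack_mult (defect a c) (tl (dropWhile (\<lambda>z. z \<noteq> None) x)) in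
       Some (Tracking (d \<noteq> []), map Some (act a c) @ None # d)
     else Some (Tracking b, stack_mult (shift a) x))"

text \<open>At the end of the input, \<open>Far\<close> accepts if some letter stands above the marker and \<open>Tracking\<close> if the
displacement is nontrivial. A point that never came close has trivial displacement, so \<open>Approach\<close>
rejects.\<close>

definition move :: "(phase, 'a, (nat \<times> bool) option) lookahead_move" where
  "move q t x = (case t of
     Letter a \<Rightarrow> (case q of
         Start \<Rightarrow> if take 1 x = [None] then Some (Far, stack_mult (shift a) x) else approach_move a x
       | Far \<Rightarrow> Some (Far, stack_mult (shift a) x)
       | Approach \<Rightarrow> approach_move a x
       | Tracking b \<Rightarrow> tracking_move b a x
       | Accept \<Rightarrow> None)
   | EndOfInput \<Rightarrow>
       if q = Far \<and> take 1 x \<noteq> [None] \<or> q = Tracking True then Some (Accept, x) else None)"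

definition accepts where
  "accepts q s w \<longleftrightarrow> (\<exists>t. lookahead_run move K q s (map Letter w @ [EndOfInput]) = Some (Accept, t))"

lemma accepts_Nil: "accepts q s [] \<longleftrightarrow> q = Far \<and> take 1 s \<noteq> [None] \<or> q = Tracking True"
  using K_gt_L by (auto simp: accepts_def move_def split: option.splits)

lemma accepts_Cons:
  "accepts q s (a # w) \<longleftrightarrow>
    (\<exists>q' r. move q (Letter a) (take K s) = Some (q', r) \<and> accepts q' (r @ drop K s) w)"
  by (auto simp: accepts_def split: option.splits)

lemma accepts_Far:
  "\<lbrakk>w \<in> lists A; u \<in> carrier F\<rbrakk> \<Longrightarrow>
    accepts Far (map Some u @ None # r) w \<longleftrightarrow> shifts w u \<noteq> []"
proof (induction w arbitrary: u)
  case Nil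
  then show ?case by (cases u) (auto simp: accepts_Nil)
next
  case (Cons a w)
  let ?s = "map Some u @ None # r"
  have a: "a \<in> A" using Cons.prems by simp
  have "stack_mult (shift a) (take K ?s) @ drop K ?s = map Some (shift a \<otimes>\<^bsub>F\<^esub> u) @ None # r"
    unfolding stack_mult_take_drop[OF add_leD2[OF shift_le_K[OF a]]]
    by (rule stack_mult_free_group(2)[OF Cons.prems(2)])
  then show ?case
    using Cons a by (simp add: accepts_Cons move_def shift_closed)
qed

lemma take_closed: "c \<in> carrier F \<Longrightarrow> take j c \<in> carrier F"
  using successively_append_iff[of _ "take j c" "drop j c"]
  by (auto simp: free_group_def reduced_def dest: in_set_takeD)

lemma accepts_Tracking:
  "\<lbrakk>w \<in> lists A; c \<in> carrier F; d \<in> carrier F\<rbrakk> \<Longrightarrow>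
    accepts (Tracking (d \<noteq> [])) (map Some c @ None # map Some d) w \<longleftrightarrow> displacement w c d \<noteq> []"
proof (induction w arbitrary: c d)
  case Nil
  then show ?case by (auto simp: accepts_Nil)
next
  case (Cons a w)
  let ?s = "map Some c @ None # map Some d"
  have a: "a \<in> A" and w: "w \<in> lists A" using Cons.prems by auto
  note c = Cons.prems(2) and d = Cons.prems(3)
  have step: "tracking_move (d \<noteq> []) a (take K ?s) = Some (Tracking (d' \<noteq> []), r)
      \<and> r @ drop K ?s = map Some (act a c) @ None # map Some d'"
    if d': "d' = defect a c \<otimes>\<^bsub>F\<^esub> d" and
      r: "r = (if length c \<le> L then map Some (act a c) @ None # stack_mult (defect a c)
                 (take (K - Suc (length c)) (map Some d)) else stack_mult (shift a) (take K ?s))" for d' r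
  proof (cases "length c \<le> L")
    case True
    let ?j = "K - Suc (length c)"
    let ?y = "stack_mult (defect a c) (take ?j (map Some d))"
    have K: "length (defect a c) < ?j" "Suc (length c) \<le> K"
      using defect_le_K[OF a c True] True K_gt_L by auto
    have take: "take K ?s = map Some c @ None # take ?j (map Some d)"
      and drop: "drop K ?s = drop ?j (map Some d)"
      using K(2) by (auto simp: take_Cons' drop_Cons' Suc_diff_le)
    have y: "?y @ drop ?j (map Some d) = map Some d'"
      using K(1) stack_mult_take_drop[of "defect a c" ?j "map Some d"] d d'
      by (simp add: stack_mult_map free_group_mult)
    \<comment> \<open>If part of the displacement is out of view, the defect is too short to cancel the visible part, so
      emptiness of the visible part decides emptiness of the displacement.\<close>
    have "?y \<noteq> []" if "drop ?j (map Some d) \<noteq> []"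
      using length_stack_mult[of "take ?j (map Some d)" "defect a c"] that K(1) by auto
    then have "?y \<noteq> [] \<longleftrightarrow> d' \<noteq> []"
      using y by (metis append_is_Nil_conv map_is_Nil_conv)
    then show ?thesis
      using True c y unfolding take drop r
      by (simp add: tracking_move_def takeWhile_append dropWhile_append comp_def)
  next
    case False
    have not_short: "\<not> min (length c) K \<le> L"
      using False K_gt_L by (simp add: min_def)
    have "take K c \<in> carrier F"
      by (rule take_closed[OF c])
    moreover have "takeWhile (\<lambda>z. z \<noteq> None) (take K ?s) = map Some (take K c)"
      by (cases "K \<le> length c") (auto simp: takeWhile_append take_map take_Cons')
    moreover have d'_d: "d' = d"
      using False a c d d' by (simp add: defect_far)
    ultimately have "tracking_move (d \<noteq> []) a (take K ?s) = Some (Tracking (d' \<noteq> []), r)"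
      using False not_short r by (simp add: tracking_move_def comp_def Let_def del: take_append)
    moreover have "stack_mult (shift a) (take K ?s) @ drop K ?s = map Some (act a c) @ None # map Some d"
      unfolding stack_mult_take_drop[OF add_leD2[OF shift_le_K[OF a]]] stack_mult_free_group(2)[OF c]
      using False a c by (simp add: act_far)
    ultimately show ?thesis
      using False r d'_d by simp
  qed
  show ?case
    using step[OF refl refl] Cons.IH[OF w act_closed[OF a c] F.m_closed[OF defect_closed[OF a c] d]]
    by (simp add: accepts_Cons move_def)
qed

text \<open>While the point is long, defects are trivial and nothing has to be recorded.\<close>

lemma accepts_Approach:
  "\<lbrakk>w \<in> lists A; c \<in> carrier F\<rbrakk> \<Longrightarrow> accepts Approach (map Some c) w \<longleftrightarrow> displacement w c [] \<noteq> []"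
proof (induction w arbitrary: c)
  case Nil
  then show ?case by (auto simp: accepts_Nil)
next
  case (Cons a w)
  then have a: "a \<in> A" and w: "w \<in> lists A" and c: "c \<in> carrier F" by auto
  have visible: "take K (map Some c) \<in> map Some ` carrier F"
    using take_closed[OF c] by (auto simp: take_map)
  show ?case
  proof (cases "length c \<le> L")
    case True
    then have "take K (map Some c) = map Some c" "drop K (map Some c) = []"
      using K_gt_L by simp_all
    then show ?thesis
      using visible True accepts_Tracking[OF w act_closed[OF a c] defect_closed[OF a c]] a c
      by (simp add: accepts_Cons move_def approach_move_def comp_def defect_closed)
  next
    case False
    have not_short: "\<not> min (length c) K \<le> L"
      using False K_gt_L by (simp add: min_def)
    have "stack_mult (shift a) (take K (map Some c)) @ drop K (map Some c) = map Some (act a c)"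
      unfolding stack_mult_take_drop[OF add_leD2[OF shift_le_K[OF a]]] stack_mult_free_group(1)[OF c]
      using False a c by (simp add: act_far)
    then show ?thesis
      using visible not_short False Cons.IH[OF w act_closed[OF a c]] a c
      by (simp add: accepts_Cons move_def approach_move_def defect_far Let_def)
  qed
qed

text \<open>A malformed stack never becomes a reduced word unless the machine gets stuck: since the shift is
shorter than the view, the last visible letter survives the multiplication, and with it any
malformation at or below it, while a malformation above it is visible.\<close>

lemma not_accepts_Approach:
  "\<lbrakk>w \<in> lists A; s \<notin> map Some ` carrier F\<rbrakk> \<Longrightarrow> \<not> accepts Approach s w"
proof (induction w arbitrary: s)
  case Nil
  then show ?case by (auto simp: accepts_Nil)
next
  case (Cons a w)
  then have a: "a \<in> A" and w: "w \<in> lists A" by auto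
  have "\<not> accepts Approach (stack_mult (shift a) (take K s) @ drop K s) w"
    and "length u > L" if visible: "take K s = map Some u" "u \<in> carrier F" for u
  proof -
    have long: "drop K s \<noteq> []"
      using visible Cons.prems(2) by (metis append_Nil2 append_take_drop_id image_eqI)
    then have K: "length u = K"
      using visible by (metis drop_eq_Nil length_map length_take linorder_not_le min.absorb2 order_less_imp_le)
    then show "length u > L" using K_gt_L by simp
    have "u \<noteq> []" using K K_gt_L by auto
    then obtain u' l where u: "u = u' @ [l]" by (metis rev_exhaust)
    have "length (shift a) \<le> length u'"
      using K shift_le_K[OF a] u by simp
    then have mult: "stack_mult (shift a) (take K s) = map Some (foldr cancel_cons (shift a) u' @ [l])"
      using stack_mult_append[of "shift a" "map Some u'" "[Some l]"] visible(1) u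
      by (simp add: stack_mult_map)
    have "stack_mult (shift a) (take K s) @ drop K s \<notin> map Some ` carrier F"
    proof
      assume "stack_mult (shift a) (take K s) @ drop K s \<in> map Some ` carrier F"
      then obtain v where v: "v \<in> carrier F"
        "map Some v = map Some (foldr cancel_cons (shift a) u' @ [l]) @ drop K s"
        unfolding mult by force
      then obtain y where y: "drop K s = map Some y" "v = (foldr cancel_cons (shift a) u' @ [l]) @ y"
        by (auto simp: map_eq_append_conv)
      \<comment> \<open>The surviving letter \<open>l\<close> overlaps both reduced words, so they can be glued there.\<close>
      have "u @ y \<in> carrier F"
        using v(1) visible(2) unfolding y u
        by (auto simp: free_group_def reduced_def successively_append_iff)
      moreover have "s = map Some (u @ y)"
        using append_take_drop_id[of K s] visible(1) y(1) by simp
      ultimately show False using Cons.prems(2) by blast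
    qed
    then show "\<not> accepts Approach (stack_mult (shift a) (take K s) @ drop K s) w"
      by (rule Cons.IH[OF w])
  qed
  note visible = this
  show ?case
  proof (cases "take K s \<in> map Some ` carrier F")
    case True
    then obtain u where u: "take K s = map Some u" "u \<in> carrier F" by blast
    have "approach_move a (take K s) = Some (Approach, stack_mult (shift a) (take K s))"
      using visible(2)[OF u] u by (simp add: approach_move_def comp_def Let_def)
    then show ?thesis
      using visible(1)[OF u] by (simp add: accepts_Cons move_def)
  next
    case False
    then show ?thesis by (simp add: accepts_Cons move_def approach_move_def)
  qed
qed

definition stack_symbols :: "(nat \<times> bool) option set" where
  "stack_symbols = insert None (Some ` ({..<n} \<times> UNIV))"

lemma map_Some_stack_symbols:
  assumes "c \<in> carrier F"
  shows "map Some c \<in> lists stack_symbols"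
proof -
  have "set c \<subseteq> {..<n} \<times> UNIV"
    using assms by (simp add: free_group_def lists_eq_set)
  then show ?thesis
    unfolding lists_eq_set mem_Collect_eq set_map stack_symbols_def
    by (intro subset_insertI2 image_mono)
qed

lemma stack_mult_stack_symbols:
  assumes "u \<in> carrier F" "s \<in> lists stack_symbols"
  shows "stack_mult u s \<in> lists stack_symbols"
  using set_stack_mult[of u s] map_Some_stack_symbols[OF assms(1)] assms(2)
  unfolding lists_eq_set mem_Collect_eq set_map by blast

lemma move_closed:
  assumes t: "t \<in> insert EndOfInput (Letter ` A)" and x: "x \<in> lists stack_symbols"
    and move: "move q t x = Some (q', r)"
  shows "r \<in> lists stack_symbols"
proof (cases t)
  case EndOfInput
  then show ?thesis using x move by (auto simp: move_def split: if_splits)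
next
  case (Letter a)
  then have a: "a \<in> A" using t by auto
  have shift: "stack_mult (shift a) x \<in> lists stack_symbols"
    by (rule stack_mult_stack_symbols[OF shift_closed[OF a] x])
  have near: "map Some (act a c) @ None # y \<in> lists stack_symbols"
    if "c \<in> carrier F" "y \<in> lists stack_symbols" for c y
    using map_Some_stack_symbols[OF act_closed[OF a that(1)]] that(2)
    unfolding lists_eq_set by (simp add: stack_symbols_def)
  have approach: "r \<in> lists stack_symbols" if m: "approach_move a x = Some (p, r)" for p r
  proof -
    obtain c where c: "x = map Some c" "c \<in> carrier F"
      using m by (auto simp: approach_move_def split: if_splits)
    have "r = map Some (act a c) @ None # map Some (defect a c) \<or> r = stack_mult (shift a) x"
      using m c by (simp add: approach_move_def comp_def Let_def split: if_splits)
    then show ?thesis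
      using shift near[OF c(2) map_Some_stack_symbols[OF defect_closed[OF a c(2)]]] by blast
  qed
  have tracking: "r \<in> lists stack_symbols" if m: "tracking_move b a x = Some (p, r)" for b p r
  proof -
    define c y where "c = map the (takeWhile (\<lambda>z. z \<noteq> None) x)"
      and "y = tl (dropWhile (\<lambda>z. z \<noteq> None) x)"
    have c: "c \<in> carrier F" and
      r: "r = map Some (act a c) @ None # stack_mult (defect a c) y \<or> r = stack_mult (shift a) x"
      using m unfolding tracking_move_def c_def[symmetric] y_def[symmetric]
      by (simp_all add: Let_def split: if_splits)
    have "set (tl z) \<subseteq> set z" for z :: "(nat \<times> bool) option list"
      by (cases z) auto
    from this[of "dropWhile (\<lambda>z. z \<noteq> None) x"] have "set y \<subseteq> set (dropWhile (\<lambda>z. z \<noteq> None) x)"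
      unfolding y_def .
    also have "\<dots> \<subseteq> set x"
      by (blast dest: set_dropWhileD)
    finally have "y \<in> lists stack_symbols"
      using x unfolding lists_eq_set by simp
    then show ?thesis
      using r shift near[OF c stack_mult_stack_symbols[OF defect_closed[OF a c]]] by blast
  qed
  have "r = stack_mult (shift a) x \<or> approach_move a x = Some (q', r) \<or>
      (\<exists>b. tracking_move b a x = Some (q', r))"
    using move unfolding move_def Letter
    by (simp split: phase.splits if_splits; blast)
  then show ?thesis
    using shift approach tracking by blast
qed

text \<open>The two kinds of initial stacks cover the two alternatives of the criterion for a moved point.\<close>

lemma accepts_Start:
  assumes "w \<in> lists A"
  shows "(\<exists>s\<in>lists stack_symbols. accepts Start s w) \<longleftrightarrow> (\<exists>p\<in>carrier F. fold act w p \<noteq> p)"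
proof (cases w)
  case Nil
  then show ?thesis by (auto simp: accepts_Nil)
next
  case (Cons a v)
  have Start: "accepts Start s w \<longleftrightarrow> accepts (if take 1 s = [None] then Far else Approach) s w" for s
    using K_gt_L by (simp add: Cons accepts_Cons move_def min_def)
  have Far: "accepts Start s w \<longleftrightarrow> shifts w [] \<noteq> []" if none: "take 1 s = [None]" for s
  proof -
    obtain r where "s = map Some [] @ None # r"
      using none by (cases s) auto
    then show ?thesis
      using accepts_Far[OF assms, of "[]" r] none by (simp add: Start)
  qed
  have Approach: "accepts Start (map Some c) w \<longleftrightarrow> displacement w c [] \<noteq> []" if "c \<in> carrier F" for c
    using accepts_Approach[OF assms that] Start[of "map Some c"] by (cases c) auto
  show ?thesis
    unfolding moved_point_iff[OF assms]
  proof
    assume "\<exists>s\<in>lists stack_symbols. accepts Start s w"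
    then obtain s where s: "accepts Start s w" by blast
    show "shifts w [] \<noteq> [] \<or> (\<exists>p\<in>carrier F. displacement w p [] \<noteq> [])"
    proof (cases "take 1 s = [None]")
      case True
      then show ?thesis using Far s by blast
    next
      case False
      then have "s \<in> map Some ` carrier F"
        using s not_accepts_Approach[OF assms, of s] by (auto simp: Start)
      then show ?thesis using Approach s by blast
    qed
  next
    assume "shifts w [] \<noteq> [] \<or> (\<exists>p\<in>carrier F. displacement w p [] \<noteq> [])"
    then show "\<exists>s\<in>lists stack_symbols. accepts Start s w"
    proof
      assume "shifts w [] \<noteq> []"
      then have "accepts Start [None] w" using Far by simp
      moreover have "[None] \<in> lists stack_symbols" by (simp add: stack_symbols_def)
      ultimately show ?thesis by blast
    next
      assume "\<exists>p\<in>carrier F. displacement w p [] \<noteq> []"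
      then show ?thesis using Approach map_Some_stack_symbols by blast
    qed
  qed
qed

theorem semidet_context_free_moving:
  "semidet_context_free A {w \<in> lists A. \<exists>p\<in>carrier F. fold act w p \<noteq> p}"
proof -
  have UNIV: "(UNIV :: phase set) = {Start, Far, Approach, Accept, Tracking True, Tracking False}"
  proof (intro equalityI subsetI)
    fix q :: phase
    show "q \<in> {Start, Far, Approach, Accept, Tracking True, Tracking False}"
      by (cases q) auto
  qed simp
  have language: "lookahead_language A stack_symbols move K Start Accept =
      {w \<in> lists A. \<exists>p\<in>carrier F. fold act w p \<noteq> p}"
    unfolding lookahead_language_def using accepts_Start unfolding accepts_def by blast
  show ?thesis
    unfolding language[symmetric]
  proof (rule semidet_context_free_lookahead[where Q = UNIV])
    show "finite (UNIV :: phase set)"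
      unfolding UNIV by simp
    show "finite stack_symbols"
      by (simp add: stack_symbols_def)
    show "q' \<in> UNIV \<and> r \<in> lists stack_symbols"
      if "t \<in> insert EndOfInput (Letter ` A)" "x \<in> lists stack_symbols" "move q t x = Some (q', r)"
      for q t x q' r
      using move_closed[OF that] by simp
  qed (simp_all add: finite_A)
qed

end

section \<open>Finite generation of the group Hou\<close>

context group
begin

text \<open>A bijection that agrees with a translation up to finitely many points is a quasi-automorphism, because
translations preserve adjacency and every vertex of the Cayley graph has finite degree: a changed
adjacency has an exceptional end and is an edge before or after applying \<open>f\<close>.\<close>

lemma Hou_carrierI:
  assumes S: "finite S" "S \<subseteq> carrier G" and f: "f \<in> Bij (carrier G)" and g: "g \<in> carrier G"
    and fin: "finite {h \<in> carrier G. f h \<noteq> g \<otimes> h}"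
  shows "f \<in> carrier (Hou G S)"
proof (rule mem_HouI[OF _ g fin])
  let ?V = "carrier G" and ?E = "cayley_edges G S"
  define D where "D = {h \<in> ?V. f h \<noteq> g \<otimes> h}"
  have bij: "bij_betw f ?V ?V" using f by (simp add: Bij_def)
  have f_closed: "f h \<in> ?V" if "h \<in> ?V" for h
    using bij that by (auto simp: bij_betw_def)
  \<comment> \<open>\<open>N X\<close> contains the edges with an end in \<open>X\<close>.\<close>
  define N where "N = (\<lambda>X. \<Union>u\<in>X. \<Union>x\<in>S. {(u, u \<otimes> x), (u \<otimes> x, u), (u, u \<otimes> inv x), (u \<otimes> inv x, u)})"
  have edge_near: "(u, v) \<in> N X" if edge: "(u, v) \<in> ?E" and near: "u \<in> X \<or> v \<in> X" for u v X
  proof -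
    obtain x where x: "x \<in> S" "v = u \<otimes> x \<or> u = v \<otimes> x" and uv: "u \<in> ?V" "v \<in> ?V"
      using edge by (auto simp: cayley_edges_def)
    then have "x \<in> ?V" using S by auto
    then have "v = u \<otimes> x \<and> u = v \<otimes> inv x \<or> u = v \<otimes> x \<and> v = u \<otimes> inv x"
      using x(2) uv by (auto simp: m_assoc)
    then show ?thesis
      using x(1) near unfolding N_def by blast
  qed
  have finite_N: "finite (N X)" if "finite X" for X
    using that S(1) by (simp add: N_def)
  have finD: "finite D" using fin by (simp add: D_def)
  have inj: "inj_on (map_prod f f) (?V \<times> ?V)"
    using bij by (auto simp: inj_on_def bij_betw_def)
  have translation: "(g \<otimes> u, g \<otimes> v) \<in> ?E \<longleftrightarrow> (u, v) \<in> ?E" if "u \<in> ?V" "v \<in> ?V" for u v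
  proof -
    have "g \<otimes> v = g \<otimes> u \<otimes> x \<longleftrightarrow> v = u \<otimes> x" "g \<otimes> u = g \<otimes> v \<otimes> x \<longleftrightarrow> u = v \<otimes> x" if "x \<in> S" for x
      using that S g \<open>u \<in> ?V\<close> \<open>v \<in> ?V\<close> by (auto simp: m_assoc)
    then show ?thesis
      using g that by (auto simp: cayley_edges_def)
  qed
  have "{(u, v) \<in> ?V \<times> ?V. ((u, v) \<in> ?E) \<noteq> ((f u, f v) \<in> ?E)}
      \<subseteq> N D \<union> (map_prod f f -` N (f ` D) \<inter> (?V \<times> ?V))"
  proof (rule subrelI)
    fix u v assume "(u, v) \<in> {(u, v) \<in> ?V \<times> ?V. ((u, v) \<in> ?E) \<noteq> ((f u, f v) \<in> ?E)}"
    then have uv: "u \<in> ?V" "v \<in> ?V" and ne: "((u, v) \<in> ?E) \<noteq> ((f u, f v) \<in> ?E)"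
      by auto
    have "u \<in> D \<or> v \<in> D"
      using ne uv translation[OF uv] by (auto simp: D_def)
    then have "(u, v) \<in> N D \<or> (f u, f v) \<in> N (f ` D)"
      using edge_near[of u v D] edge_near[of "f u" "f v" "f ` D"] ne by blast
    then show "(u, v) \<in> N D \<union> (map_prod f f -` N (f ` D) \<inter> (?V \<times> ?V))"
      using uv by simp
  qed
  moreover have "finite (map_prod f f -` N (f ` D) \<inter> (?V \<times> ?V))"
    by (intro finite_vimage_IntI finite_N finite_imageI finD inj)
  ultimately have "finite {(u, v) \<in> ?V \<times> ?V. ((u, v) \<in> ?E) \<noteq> ((f u, f v) \<in> ?E)}"
    by (meson finite_N finD finite_UnI finite_subset)
  then show "quasi_automorphism ?V ?E f"
    using f by (simp add: quasi_automorphism_def)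
qed

lemma Hou_Bij: "f \<in> carrier (Hou G S) \<Longrightarrow> f \<in> Bij (carrier G)"
  by (simp add: Hou_def quasi_automorphism_def)

lemma Hou_apply_closed: "\<lbrakk>f \<in> carrier (Hou G S); x \<in> carrier G\<rbrakk> \<Longrightarrow> f x \<in> carrier G"
  using Hou_Bij[of f S] Bij_imp_funcset[of f "carrier G"] by auto

lemma Hou_mult:
  "\<lbrakk>f \<in> carrier (Hou G S); h \<in> carrier (Hou G S)\<rbrakk>
    \<Longrightarrow> f \<otimes>\<^bsub>Hou G S\<^esub> h = compose (carrier G) f h"
  using Hou_Bij[of f S] Hou_Bij[of h S] by (simp add: Hou_def BijGroup_def)

lemma Hou_mult_apply:
  "\<lbrakk>f \<in> carrier (Hou G S); h \<in> carrier (Hou G S); x \<in> carrier G\<rbrakk>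
    \<Longrightarrow> (f \<otimes>\<^bsub>Hou G S\<^esub> h) x = f (h x)"
  by (simp add: Hou_mult compose_eq)

lemma Hou_one_apply: "x \<in> carrier G \<Longrightarrow> \<one>\<^bsub>Hou G S\<^esub> x = x"
  by (simp add: Hou_def BijGroup_def)

lemma Hou_eqI:
  "\<lbrakk>f \<in> carrier (Hou G S); h \<in> carrier (Hou G S); \<And>x. x \<in> carrier G \<Longrightarrow> f x = h x\<rbrakk> \<Longrightarrow> f = h"
  by (rule extensionalityI[OF Bij_imp_extensional[OF Hou_Bij] Bij_imp_extensional[OF Hou_Bij]])

lemma Hou_almost_translation:
  "f \<in> carrier (Hou G S) \<Longrightarrow> \<exists>g\<in>carrier G. finite {h \<in> carrier G. f h \<noteq> g \<otimes> h}"
  by (simp add: Hou_def)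

definition translation where
  "translation g = (\<lambda>x\<in>carrier G. g \<otimes> x)"

definition swap where
  "swap u v = (\<lambda>x\<in>carrier G. transpose u v x)"

lemma translation_Hou:
  assumes "finite S" "S \<subseteq> carrier G" "g \<in> carrier G"
  shows "translation g \<in> carrier (Hou G S)"
proof (rule Hou_carrierI[OF assms(1,2) _ assms(3)])
  have "bij_betw (translation g) (carrier G) (carrier G)"
    using assms(3) by (intro bij_betw_byWitness[where f' = "\<lambda>x. inv g \<otimes> x"])
      (auto simp: translation_def m_assoc[symmetric])
  then show "translation g \<in> Bij (carrier G)"
    by (auto simp: Bij_def translation_def)
  have "{h \<in> carrier G. translation g h \<noteq> g \<otimes> h} = {}"
    by (auto simp: translation_def)
  then show "finite {h \<in> carrier G. translation g h \<noteq> g \<otimes> h}"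
    by (metis finite.emptyI)
qed

lemma permutes_Hou:
  assumes S: "finite S" "S \<subseteq> carrier G" and p: "p permutes D" and D: "finite D" "D \<subseteq> carrier G"
  shows "restrict p (carrier G) \<in> carrier (Hou G S)"
proof (rule Hou_carrierI[OF S _ one_closed])
  have "p permutes carrier G"
    by (rule permutes_subset[OF p D(2)])
  then show "restrict p (carrier G) \<in> Bij (carrier G)"
    by (simp add: Bij_def permutes_imp_bij)
  have "{h \<in> carrier G. restrict p (carrier G) h \<noteq> \<one> \<otimes> h} \<subseteq> D"
    using p by (auto simp: permutes_def)
  then show "finite {h \<in> carrier G. restrict p (carrier G) h \<noteq> \<one> \<otimes> h}"
    by (rule finite_subset[OF _ D(1)])
qed

lemma swap_Hou:
  assumes "finite S" "S \<subseteq> carrier G" "u \<in> carrier G" "v \<in> carrier G"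
  shows "swap u v \<in> carrier (Hou G S)"
  using permutes_Hou[OF assms(1,2) permutes_swap_id[of u "{u, v}" v]] assms(3,4)
  by (simp add: swap_def)

text \<open>The elements \<open>v\<close> for which the transposition of \<open>1\<close> and \<open>v\<close> is generated contain the generators
and are closed under products and inverses: translations carry the transposition of \<open>1\<close> and \<open>b\<close> to that
of \<open>a\<close> and \<open>a b\<close>, and conjugating adjacent transpositions yields the one of the outer points. Every
element of the group is a translation times a permutation with finite support.\<close>

lemma finite_generating_set_Hou:
  assumes "finite_generating_set G S"
  shows "finite_generating_set (Hou G S) (translation ` S \<union> swap \<one> ` S)"
proof -
  let ?H = "Hou G S" and ?X = "translation ` S \<union> swap \<one> ` S"
  let ?W = "generate ?H ?X"
  have S: "finite S" "S \<subseteq> carrier G" and gen: "generate G S = carrier G"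
    using assms by (auto simp: finite_generating_set_def)
  interpret H: group ?H by (rule group_Hou[OF is_group])
  have X: "?X \<subseteq> carrier ?H"
    using translation_Hou[OF S] swap_Hou[OF S one_closed] S(2) by auto
  note tr = translation_Hou[OF S] and sw = swap_Hou[OF S]
  have W: "?W \<subseteq> carrier ?H" by (rule H.generate_incl[OF X])
  have mult: "f \<otimes>\<^bsub>?H\<^esub> h \<in> ?W" if "f \<in> ?W" "h \<in> ?W" for f h
    using that by (rule generate.eng)
  have translation_one: "translation \<one> = \<one>\<^bsub>?H\<^esub>"
    by (rule Hou_eqI[OF tr[OF one_closed] H.one_closed]) (simp add: translation_def Hou_one_apply)
  have translation_mult: "translation (a \<otimes> b) = translation a \<otimes>\<^bsub>?H\<^esub> translation b"
    if "a \<in> carrier G" "b \<in> carrier G" for a b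
  proof (rule Hou_eqI[of _ S])
    fix x assume "x \<in> carrier G"
    then show "translation (a \<otimes> b) x = (translation a \<otimes>\<^bsub>?H\<^esub> translation b) x"
      using that by (simp add: Hou_mult_apply tr) (simp add: translation_def m_assoc)
  qed (use that in \<open>simp_all add: tr\<close>)
  have translation_W: "translation g \<in> ?W" if "g \<in> carrier G" for g
    using that unfolding gen[symmetric]
  proof (induction rule: generate.induct)
    case one
    then show ?case by (simp add: translation_one generate.one)
  next
    case (incl x)
    then show ?case by (intro generate.incl) auto
  next
    case (inv x)
    then have x: "x \<in> carrier G" using S by auto
    have "inv\<^bsub>?H\<^esub> translation x = translation (inv x)"
      using translation_mult[of "inv x" x] x
      by (intro H.inv_equality) (simp_all add: tr translation_one)
    then show ?case
      using generate.inv[of "translation x" ?X ?H] inv by auto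
  next
    case (eng a b)
    then show ?case
      using translation_mult[of a b] mult gen by metis
  qed
  have conj: "swap (g \<otimes> u) (g \<otimes> v) =
      translation g \<otimes>\<^bsub>?H\<^esub> (swap u v \<otimes>\<^bsub>?H\<^esub> translation (inv g))"
    if "g \<in> carrier G" "u \<in> carrier G" "v \<in> carrier G" for g u v
  proof (rule Hou_eqI[of _ S])
    fix x assume x: "x \<in> carrier G"
    have "inv g \<otimes> x = u \<longleftrightarrow> x = g \<otimes> u" "inv g \<otimes> x = v \<longleftrightarrow> x = g \<otimes> v"
      using that x inv_solve_left' by auto
    then show "swap (g \<otimes> u) (g \<otimes> v) x =
        (translation g \<otimes>\<^bsub>?H\<^esub> (swap u v \<otimes>\<^bsub>?H\<^esub> translation (inv g))) x"
      using that x
      by (simp add: Hou_mult_apply tr sw Hou_apply_closed)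
        (simp add: translation_def swap_def transpose_def m_assoc[symmetric])
  qed (use that in \<open>simp_all add: tr sw\<close>)
  have swap_shift: "swap (g \<otimes> u) (g \<otimes> v) \<in> ?W"
    if "g \<in> carrier G" "u \<in> carrier G" "v \<in> carrier G" "swap u v \<in> ?W" for g u v
    unfolding conj[OF that(1-3)] using that translation_W by (intro mult) auto
  have swap_commute: "swap u v = swap v u" for u v
    by (simp add: swap_def transpose_commute)
  have swap_same: "swap u u = \<one>\<^bsub>?H\<^esub>" if "u \<in> carrier G" for u
    by (rule Hou_eqI[OF sw[OF that that] H.one_closed]) (simp add: swap_def Hou_one_apply)
  have swap_trans: "swap u w \<in> ?W"
    if "u \<in> carrier G" "v \<in> carrier G" "w \<in> carrier G" "swap u v \<in> ?W" "swap v w \<in> ?W" for u v w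
  proof (cases "u = w \<or> u = v \<or> v = w")
    case True
    then show ?thesis using that swap_same generate.one by metis
  next
    case False
    have "swap u w = swap u v \<otimes>\<^bsub>?H\<^esub> (swap v w \<otimes>\<^bsub>?H\<^esub> swap u v)"
    proof (rule Hou_eqI[of _ S])
      fix x assume x: "x \<in> carrier G"
      then show "swap u w x = (swap u v \<otimes>\<^bsub>?H\<^esub> (swap v w \<otimes>\<^bsub>?H\<^esub> swap u v)) x"
        using that False
        by (simp add: Hou_mult_apply sw Hou_apply_closed) (auto simp: swap_def transpose_def)
    qed (use that in \<open>simp_all add: sw\<close>)
    then show ?thesis using that mult by metis
  qed
  have swap_one: "swap \<one> v \<in> ?W" if "v \<in> carrier G" for v
    using that unfolding gen[symmetric]
  proof (induction rule: generate.induct)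
    case one
    then show ?case by (simp add: swap_same generate.one)
  next
    case (incl x)
    then show ?case by (intro generate.incl) auto
  next
    case (inv x)
    then have x: "x \<in> carrier G" using S by auto
    have "swap \<one> x \<in> ?W" using inv by (intro generate.incl) auto
    from swap_shift[OF inv_closed[OF x] one_closed x this]
    show ?case using x swap_commute by simp
  next
    case (eng a b)
    then have ab: "a \<in> carrier G" "b \<in> carrier G" using gen by auto
    show ?case
      using swap_trans[OF one_closed ab(1) m_closed[OF ab] eng.IH(1)]
        swap_shift[OF ab(1) one_closed ab(2) eng.IH(2)] ab by simp
  qed
  have swap_W: "swap u v \<in> ?W" if "u \<in> carrier G" "v \<in> carrier G" for u v
    using swap_trans[OF that(1) one_closed that(2)] swap_one that swap_commute by metis
  have permutes_W: "restrict p (carrier G) \<in> ?W"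
    if "p permutes D" "finite D" "D \<subseteq> carrier G" for p D
    using that
  proof (induction rule: permutes_induct)
    case id
    have "restrict id (carrier G) = \<one>\<^bsub>?H\<^esub>"
      by (simp add: Hou_def BijGroup_def id_def)
    then show ?case by (metis generate.one)
  next
    case (swap a b p)
    have ab: "a \<in> carrier G" "b \<in> carrier G" using swap by auto
    have p: "restrict p (carrier G) \<in> ?W"
      by (rule swap.IH[OF swap.prems])
    have "p permutes carrier G"
      by (rule permutes_subset[OF swap.hyps(4) swap.prems])
    then have "p x \<in> carrier G" if "x \<in> carrier G" for x
      using that by (simp add: permutes_in_image)
    then have "restrict (transpose a b \<circ> p) (carrier G) = compose (carrier G) (swap a b) (restrict p (carrier G))"
      by (auto simp: compose_def swap_def)
    also have "\<dots> = swap a b \<otimes>\<^bsub>?H\<^esub> restrict p (carrier G)"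
      by (rule Hou_mult[symmetric, OF sw[OF ab] subsetD[OF W p]])
    finally show ?case
      using mult[OF swap_W[OF ab] p] by metis
  qed
  have all: "f \<in> ?W" if f: "f \<in> carrier ?H" for f
  proof -
    obtain g where g: "g \<in> carrier G" and fin: "finite {h \<in> carrier G. f h \<noteq> g \<otimes> h}"
      using Hou_almost_translation[OF f] by blast
    let ?D = "{h \<in> carrier G. f h \<noteq> g \<otimes> h}"
    define h where "h = translation (inv g) \<otimes>\<^bsub>?H\<^esub> f"
    have h: "h \<in> carrier ?H" using f g by (simp add: h_def tr)
    define p where "p x = (if x \<in> carrier G then h x else x)" for x
    have fixed: "h x = x \<longleftrightarrow> f x = g \<otimes> x" if "x \<in> carrier G" for x
    proof -
      have "h x = inv g \<otimes> f x"
        using that f g Hou_apply_closed[OF f that]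
        by (simp add: h_def Hou_mult_apply tr) (simp add: translation_def)
      then show ?thesis
        using that g Hou_apply_closed[OF f that] inv_solve_left' by auto
    qed
    have "bij_betw p (carrier G) (carrier G)"
      using Hou_Bij[OF h] by (subst bij_betw_cong[of _ _ h]) (auto simp: p_def Bij_def)
    then have "p permutes carrier G"
      by (intro bij_imp_permutes) (auto simp: p_def)
    then have "p permutes ?D"
      by (rule permutes_superset) (auto simp: p_def fixed)
    then have "restrict p (carrier G) \<in> ?W"
      using permutes_W[of p ?D] fin by blast
    moreover have "restrict p (carrier G) = h"
      using Bij_imp_extensional[OF Hou_Bij[OF h]] by (auto simp: p_def restrict_def extensional_def)
    ultimately have "translation g \<otimes>\<^bsub>?H\<^esub> h \<in> ?W"
      by (intro mult translation_W g) simp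
    moreover have "translation g \<otimes>\<^bsub>?H\<^esub> h = f"
      using f g by (simp add: h_def tr H.m_assoc[symmetric] flip: translation_mult)
        (simp add: translation_one)
    ultimately show ?thesis by simp
  qed
  have "?W = carrier ?H"
    by (intro subset_antisym[OF W] subsetI all)
  moreover have "finite ?X"
    by (intro finite_UnI finite_imageI S(1))
  ultimately show ?thesis
    unfolding finite_generating_set_def by (rule conjI[OF _ conjI[OF X], rotated])
qed

end

section \<open>The co-word problem\<close>

lemma (in group) letter_val_closed: "fst a \<in> carrier G \<Longrightarrow> letter_val G a \<in> carrier G"
  by (simp add: letter_val_def)

lemma (in group) word_val_closed:
  "w \<in> lists (T \<times> UNIV) \<Longrightarrow> T \<subseteq> carrier G \<Longrightarrow> word_val G w \<in> carrier G"
  by (induction w) (auto simp: word_val_def letter_val_def subset_iff)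

lemma word_val_Cons: "word_val G (a # w) = letter_val G a \<otimes>\<^bsub>G\<^esub> word_val G w"
  by (simp add: word_val_def)

text \<open>The leftmost letter of a word is applied last to a point, whereas the automaton meets it first. Hence the
word is replaced by its inverse, which applies the inverse of the first letter first.\<close>

lemma (in group) coW_Hou:
  assumes T: "T \<subseteq> carrier (Hou G S)"
  shows "coW (Hou G S) T = {w \<in> lists (T \<times> UNIV).
    \<exists>p\<in>carrier G. fold (\<lambda>a. inv\<^bsub>Hou G S\<^esub> (letter_val (Hou G S) a)) w p \<noteq> p}"
proof -
  let ?H = "Hou G S"
  interpret H: group ?H by (rule group_Hou[OF is_group])
  let ?inv = "\<lambda>a. inv\<^bsub>?H\<^esub> (letter_val ?H a)"
  have undo: "fold ?inv w (word_val ?H w p) = p"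
    if "w \<in> lists (T \<times> UNIV)" "p \<in> carrier G" for w p
    using that
  proof (induction w)
    case Nil
    then show ?case by (simp add: word_val_def Hou_one_apply)
  next
    case (Cons a w)
    have "fst a \<in> T"
      using Cons.hyps(1) by (cases a) simp
    then have a: "letter_val ?H a \<in> carrier ?H"
      using T by (intro H.letter_val_closed) blast
    have w: "word_val ?H w \<in> carrier ?H"
      by (rule H.word_val_closed[OF Cons.hyps(2) T])
    have "?inv a (letter_val ?H a (word_val ?H w p)) = word_val ?H w p"
      using Hou_mult_apply[OF H.inv_closed[OF a] a Hou_apply_closed[OF w]] Cons.prems
        Hou_apply_closed[OF w] a by (simp add: Hou_one_apply)
    then show ?case
      using Cons a w by (simp add: word_val_Cons Hou_mult_apply)
  qed
  have "word_val ?H w = \<one>\<^bsub>?H\<^esub> \<longleftrightarrow> (\<forall>p\<in>carrier G. fold ?inv w p = p)"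
    if w: "w \<in> lists (T \<times> UNIV)" for w
  proof
    assume "word_val ?H w = \<one>\<^bsub>?H\<^esub>"
    then show "\<forall>p\<in>carrier G. fold ?inv w p = p"
      using undo[OF w] Hou_one_apply by metis
  next
    assume fixed: "\<forall>p\<in>carrier G. fold ?inv w p = p"
    have W: "word_val ?H w \<in> carrier ?H" by (rule H.word_val_closed[OF w T])
    show "word_val ?H w = \<one>\<^bsub>?H\<^esub>"
    proof (rule Hou_eqI[OF W H.one_closed])
      fix p assume "p \<in> carrier G"
      then show "word_val ?H w p = \<one>\<^bsub>?H\<^esub> p"
        using undo[OF w] fixed Hou_apply_closed[OF W] Hou_one_apply by metis
    qed
  qed
  then show ?thesis
    unfolding coW_def by blast
qed

lemma semidet_context_free_coW_Hou:
  assumes n: "n \<ge> 1" and T: "finite T" "T \<subseteq> carrier (Hou (free_group n) S)"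
  shows "semidet_context_free (T \<times> UNIV) (coW (Hou (free_group n) S) T)"
proof -
  let ?H = "Hou (free_group n) S"
  interpret F: group "free_group n" by (rule group_free_group)
  interpret H: group ?H by (rule group_Hou[OF group_free_group])
  define act where "act a = inv\<^bsub>?H\<^esub> (letter_val ?H a)" for a
  have act: "act a \<in> carrier ?H" if "a \<in> T \<times> UNIV" for a
    unfolding act_def using that T(2) by (intro H.inv_closed H.letter_val_closed) auto
  have "\<forall>a\<in>T \<times> UNIV. \<exists>g. g \<in> carrier (free_group n) \<and>
      finite {c \<in> carrier (free_group n). act a c \<noteq> g \<otimes>\<^bsub>free_group n\<^esub> c}"
    using F.Hou_almost_translation[OF act] unfolding Bex_def by (intro ballI) assumption
  from bchoice[OF this] obtain shift where
    "\<forall>a\<in>T \<times> UNIV. shift a \<in> carrier (free_group n) \<and>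
      finite {c \<in> carrier (free_group n). act a c \<noteq> shift a \<otimes>\<^bsub>free_group n\<^esub> c}" ..
  then have shift: "shift a \<in> carrier (free_group n)"
    "finite {c \<in> carrier (free_group n). act a c \<noteq> shift a \<otimes>\<^bsub>free_group n\<^esub> c}"
    if "a \<in> T \<times> UNIV" for a
    using that by blast+
  let ?D = "\<Union>a\<in>T \<times> UNIV. {c \<in> carrier (free_group n). act a c \<noteq> shift a \<otimes>\<^bsub>free_group n\<^esub> c}"
  have "finite (length ` ?D)"
    by (intro finite_imageI finite_UN_I finite_cartesian_product T(1) finite shift(2))
  then obtain L where "\<forall>l\<in>length ` ?D. l \<le> L"
    unfolding finite_nat_set_iff_bounded_le by blast
  then have L: "length c \<le> L" if "c \<in> ?D" for c
    using that by blast
  interpret almost_translation_action n "T \<times> UNIV" act shift L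
  proof
    show "act a c = shift a \<otimes>\<^bsub>free_group n\<^esub> c"
      if "a \<in> T \<times> UNIV" "c \<in> carrier (free_group n)" "L < length c" for a c
      using L[of c] that by fastforce
    show "act a c \<in> carrier (free_group n)" if "a \<in> T \<times> UNIV" "c \<in> carrier (free_group n)" for a c
      by (rule F.Hou_apply_closed[OF act[OF that(1)] that(2)])
    show "n \<ge> 1" by (rule n)
    show "finite (T \<times> (UNIV :: bool set))" by (intro finite_cartesian_product T(1) finite)
    show "shift a \<in> carrier (free_group n)" if "a \<in> T \<times> UNIV" for a by (rule shift(1)[OF that])
  qed
  show ?thesis
    using semidet_context_free_moving unfolding F.coW_Hou[OF T(2)] act_def .
qed

theorem theorem3:
  fixes n :: nat and S :: "(nat \<times> bool) list set"
  assumes "n \<ge> 1"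
    and "finite_generating_set (free_group n) S"
  shows "coW_semidet_context_free (Hou (free_group n) S)"
  unfolding coW_semidet_context_free_def
proof (intro conjI allI impI)
  show "\<exists>X. finite_generating_set (Hou (free_group n) S) X"
    using group.finite_generating_set_Hou[OF group_free_group assms(2)] by blast
  show "semidet_context_free (T \<times> UNIV) (coW (Hou (free_group n) S) T)"
    if "finite_generating_set (Hou (free_group n) S) T" for T
    using that assms(1) by (intro semidet_context_free_coW_Hou) (auto simp: finite_generating_set_def)
qed

end
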